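(* Let $\mathbb{F}$ be a field of characteristic two. For every $n\in\mathbb{N}$, the Lie algebras $\mathfrak{m}_0(n)$ and $\mathfrak{m}_2(n)$ over $\mathbb{F}$ have the same Betti numbers, i.e. $\dim H^k(\mathfrak{m}_0(n),\mathbb{F})=\dim H^k(\mathfrak{m}_2(n),\mathbb{F})$ for all $k$.
   Context: $\mathbb{F}$ is a field of characteristic two, and cohomology is Lie algebra (Chevalley–Eilenberg) cohomology with trivial coefficients. The $k$-th Betti number of a finite-dimensional Lie algebra $\mathfrak{g}$ over $\mathbb{F}$ is $\dim_{\mathbb{F}} H^k(\mathfrak{g},\mathbb{F})$. $\mathfrak{m}_0(n)$ is the Lie algebra over $\mathbb{F}$ with basis $e_1,\dots,e_n$ and relations $[e_1,e_i]=e_{i+1}$ for $2\le i\le n-1$. $\mathfrak{m}_2(n)$ is the Lie algebra over $\mathbb{F}$ with basis $e_1,\dots,e_n$ and relations $[e_1,e_i]=e_{i+1}$ for $2\le i\le n-1$ and $[e_2,e_j]=e_{j+2}$ for $3\le j\le n-2$. Brackets of basis elements which are not listed, and do not follow from the listed ones by skew-symmetry, are zero. *)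

theory Defs
  imports "Jordan_Normal_Form.VS_Connect" "HOL-Algebra.QuotRing"
begin

record ('a, 'b) lie_algebra = "('a, 'b) module" +
  lie_bracket :: "'b \<Rightarrow> 'b \<Rightarrow> 'b"

text \<open>Alternation is required in the form \<open>[x, x] = 0\<close>, which in characteristic two is
  stronger than skew-symmetry.\<close>

locale lie_algebra = vectorspace K L for K :: "('k, 'm) ring_scheme" (structure)
    and L :: "('k, 'v, 'n) lie_algebra_scheme" (structure) +
  assumes lie_bracket_closed:
      "\<lbrakk>x \<in> carrier L; y \<in> carrier L\<rbrakk> \<Longrightarrow> lie_bracket L x y \<in> carrier L"
    and lie_bracket_add_left:
      "\<lbrakk>x \<in> carrier L; y \<in> carrier L; z \<in> carrier L\<rbrakk> \<Longrightarrow>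
       lie_bracket L (x \<oplus>\<^bsub>L\<^esub> y) z = lie_bracket L x z \<oplus>\<^bsub>L\<^esub> lie_bracket L y z"
    and lie_bracket_add_right:
      "\<lbrakk>x \<in> carrier L; y \<in> carrier L; z \<in> carrier L\<rbrakk> \<Longrightarrow>
       lie_bracket L x (y \<oplus>\<^bsub>L\<^esub> z) = lie_bracket L x y \<oplus>\<^bsub>L\<^esub> lie_bracket L x z"
    and lie_bracket_smult_left:
      "\<lbrakk>a \<in> carrier K; x \<in> carrier L; y \<in> carrier L\<rbrakk> \<Longrightarrow>
       lie_bracket L (a \<odot>\<^bsub>L\<^esub> x) y = a \<odot>\<^bsub>L\<^esub> lie_bracket L x y"
    and lie_bracket_smult_right:
      "\<lbrakk>a \<in> carrier K; x \<in> carrier L; y \<in> carrier L\<rbrakk> \<Longrightarrow>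
       lie_bracket L x (a \<odot>\<^bsub>L\<^esub> y) = a \<odot>\<^bsub>L\<^esub> lie_bracket L x y"
    and lie_bracket_self: "x \<in> carrier L \<Longrightarrow> lie_bracket L x x = \<zero>\<^bsub>L\<^esub>"
    and jacobi: "\<lbrakk>x \<in> carrier L; y \<in> carrier L; z \<in> carrier L\<rbrakk> \<Longrightarrow>
       lie_bracket L x (lie_bracket L y z) \<oplus>\<^bsub>L\<^esub> lie_bracket L y (lie_bracket L z x)
         \<oplus>\<^bsub>L\<^esub> lie_bracket L z (lie_bracket L x y) = \<zero>\<^bsub>L\<^esub>"


section \<open>Chevalley--Eilenberg cohomology with trivial coefficients\<close>

definition tuples :: "('a, 'b, 'm) module_scheme \<Rightarrow> nat \<Rightarrow> 'b list set" where
  "tuples V k = {xs. length xs = k \<and> set xs \<subseteq> carrier V}"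

text \<open>A \<open>k\<close>-linear form is a function on lists, normalised to be \<open>0\<close> outside the
  \<open>k\<close>-tuples of vectors so that equality of forms is equality of functions.\<close>

definition alternating_forms ::
    "('a::field, 'b, 'm) module_scheme \<Rightarrow> nat \<Rightarrow> ('b list \<Rightarrow> 'a) set" where
  "alternating_forms V k = {w.
     (\<forall>xs. xs \<notin> tuples V k \<longrightarrow> w xs = 0) \<and>
     (\<forall>xs\<in>tuples V k. \<forall>i<k. \<forall>x\<in>carrier V. \<forall>y\<in>carrier V.
        w (xs[i := x \<oplus>\<^bsub>V\<^esub> y]) = w (xs[i := x]) + w (xs[i := y])) \<and>
     (\<forall>xs\<in>tuples V k. \<forall>i<k. \<forall>a. \<forall>x\<in>carrier V.
        w (xs[i := a \<odot>\<^bsub>V\<^esub> x]) = a * w (xs[i := x])) \<and>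
     (\<forall>xs\<in>tuples V k. \<not> distinct xs \<longrightarrow> w xs = 0)}"

definition cochains ::
    "('a::field, 'b, 'm) lie_algebra_scheme \<Rightarrow> nat \<Rightarrow> ('a, 'b list \<Rightarrow> 'a) module" where
  "cochains L k = \<lparr>carrier = alternating_forms L k, mult = undefined, one = undefined,
     zero = (\<lambda>xs. 0), add = (\<lambda>v w xs. v xs + w xs), smult = (\<lambda>a w xs. a * w xs)\<rparr>"

text \<open>The coboundary operator
  \<open>(dw)(x\<^sub>0,\<dots>,x\<^sub>k) = \<Sum>\<^sub>i\<^sub><\<^sub>j (-1)\<^sup>i\<^sup>+\<^sup>j w([x\<^sub>i,x\<^sub>j], x\<^sub>0,\<dots>,x\<^sub>k)\<close>, where \<open>x\<^sub>i\<close> and \<open>x\<^sub>j\<close> are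
  omitted from the trailing arguments.\<close>

definition coboundary ::
    "('a::field, 'b, 'm) lie_algebra_scheme \<Rightarrow> nat \<Rightarrow> ('b list \<Rightarrow> 'a) \<Rightarrow> 'b list \<Rightarrow> 'a" where
  "coboundary L k w = (\<lambda>xs. if xs \<in> tuples L (Suc k)
     then \<Sum>j<Suc k. \<Sum>i<j. (- 1) ^ (i + j) *
            w (lie_bracket L (xs ! i) (xs ! j) # nths xs (- {i, j}))
     else 0)"

definition cocycles ::
    "('a::field, 'b, 'm) lie_algebra_scheme \<Rightarrow> nat \<Rightarrow> ('b list \<Rightarrow> 'a) set" where
  "cocycles L k = {w \<in> alternating_forms L k. coboundary L k w = (\<lambda>xs. 0)}"

definition coboundaries ::
    "('a::field, 'b, 'm) lie_algebra_scheme \<Rightarrow> nat \<Rightarrow> ('b list \<Rightarrow> 'a) set" where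
  "coboundaries L k = (case k of 0 \<Rightarrow> {\<lambda>xs. 0}
     | Suc j \<Rightarrow> coboundary L j ` alternating_forms L j)"

text \<open>The quotient of a module by a submodule, on the set of cosets. The union in the scalar
  multiplication is over equal cosets, as in \<^const>\<open>rcoset_mult\<close>.\<close>

definition quotient_module ::
    "('a, 'b, 'm) module_scheme \<Rightarrow> 'b set \<Rightarrow> ('a, 'b set) module" where
  "quotient_module V W = \<lparr>carrier = a_rcosets\<^bsub>V\<^esub> W, mult = undefined, one = undefined,
     zero = W, add = (\<lambda>A B. A <+>\<^bsub>V\<^esub> B), smult = (\<lambda>a A. \<Union>x\<in>A. W +>\<^bsub>V\<^esub> (a \<odot>\<^bsub>V\<^esub> x))\<rparr>"

definition cohomology ::
    "('a::field, 'b, 'm) lie_algebra_scheme \<Rightarrow> nat \<Rightarrow> ('a, ('b list \<Rightarrow> 'a) set) module" where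
  "cohomology L k =
     quotient_module ((cochains L k)\<lparr>carrier := cocycles L k\<rparr>) (coboundaries L k)"

definition betti :: "('a::field, 'b, 'm) lie_algebra_scheme \<Rightarrow> nat \<Rightarrow> nat" where
  "betti L k = vectorspace.dim class_ring (cohomology L k)"


section \<open>The Lie algebras \<open>\<mm>\<^sub>0(n)\<close> and \<open>\<mm>\<^sub>2(n)\<close>\<close>

text \<open>A space with basis \<open>e\<^sub>1,\<dots>,e\<^sub>n\<close> is given by coordinate functions supported in
  \<open>{1..n}\<close>.\<close>

definition basis_vec :: "nat \<Rightarrow> nat \<Rightarrow> 'a::field" where
  "basis_vec i = (\<lambda>j. if j = i then 1 else 0)"

text \<open>\<open>c i j\<close> is the bracket \<open>[e\<^sub>i, e\<^sub>j]\<close> for \<open>i < j\<close>; the remaining values of \<open>c\<close> are not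
  used. The bracket is the alternating bilinear extension
  \<open>[x, y] = \<Sum>\<^sub>i\<^sub><\<^sub>j (x\<^sub>i y\<^sub>j - x\<^sub>j y\<^sub>i) [e\<^sub>i, e\<^sub>j]\<close>.\<close>

definition lie_of_basis_brackets ::
    "nat \<Rightarrow> (nat \<Rightarrow> nat \<Rightarrow> nat \<Rightarrow> 'a::field) \<Rightarrow> ('a, nat \<Rightarrow> 'a) lie_algebra" where
  "lie_of_basis_brackets n c = \<lparr>carrier = {x. \<forall>i. i \<notin> {1..n} \<longrightarrow> x i = 0},
     mult = undefined, one = undefined, zero = (\<lambda>i. 0),
     add = (\<lambda>x y i. x i + y i), smult = (\<lambda>a x i. a * x i),
     lie_bracket = (\<lambda>x y l. \<Sum>j\<in>{1..n}. \<Sum>i\<in>{1..<j}. (x i * y j - x j * y i) * c i j l)\<rparr>"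

definition m0 :: "nat \<Rightarrow> ('a::field, nat \<Rightarrow> 'a) lie_algebra" where
  "m0 n = lie_of_basis_brackets n (\<lambda>i j.
     if i = 1 \<and> 2 \<le> j \<and> j + 1 \<le> n then basis_vec (j + 1) else (\<lambda>l. 0))"

definition m2 :: "nat \<Rightarrow> ('a::field, nat \<Rightarrow> 'a) lie_algebra" where
  "m2 n = lie_of_basis_brackets n (\<lambda>i j.
     if i = 1 \<and> 2 \<le> j \<and> j + 1 \<le> n then basis_vec (j + 1)
     else if i = 2 \<and> 3 \<le> j \<and> j + 2 \<le> n then basis_vec (j + 2)
     else (\<lambda>l. 0))"


lemma m0_bracket_coord:
  "lie_bracket (m0 n) x y l = (if l \<in> {3..n} then x 1 * y (l - 1) - x (l - 1) * y 1 else 0)"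
proof -
  have "lie_bracket (m0 n) x y l = (\<Sum>j\<in>{1..n}. \<Sum>i\<in>{1..<j}.
      if i = 1 then (if j = l - 1 \<and> l \<in> {3..n} then x 1 * y j - x j * y 1 else 0) else 0)"
    unfolding m0_def lie_of_basis_brackets_def lie_algebra.select_convs
    by (intro sum.cong refl) (auto simp: basis_vec_def)
  also have "\<dots> = (\<Sum>j\<in>{1..n}. if j = l - 1 then
      (if l \<in> {3..n} then x 1 * y j - x j * y 1 else 0) else 0)"
    by (intro sum.cong refl) (auto simp: sum.delta)
  also have "\<dots> = (if l \<in> {3..n} then x 1 * y (l - 1) - x (l - 1) * y 1 else 0)"
    by (subst sum.delta) auto
  finally show ?thesis .
qed

lemma m2_bracket_coord:
  "lie_bracket (m2 n) x y l =
     (if l \<in> {3..n} then x 1 * y (l - 1) - x (l - 1) * y 1 else 0) +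
     (if l \<in> {5..n} then x 2 * y (l - 2) - x (l - 2) * y 2 else 0)"
proof -
  have "lie_bracket (m2 n) x y l = (\<Sum>j\<in>{1..n}. \<Sum>i\<in>{1..<j}.
      (if i = 1 then (if j = l - 1 \<and> l \<in> {3..n} then x 1 * y j - x j * y 1 else 0) else 0) +
      (if i = 2 then (if j = l - 2 \<and> l \<in> {5..n} then x 2 * y j - x j * y 2 else 0) else 0))"
    unfolding m2_def lie_of_basis_brackets_def lie_algebra.select_convs
    by (intro sum.cong refl) (auto simp: basis_vec_def)
  also have "\<dots> = (\<Sum>j\<in>{1..n}.
      (if j = l - 1 then (if l \<in> {3..n} then x 1 * y j - x j * y 1 else 0) else 0) +
      (if j = l - 2 then (if l \<in> {5..n} then x 2 * y j - x j * y 2 else 0) else 0))"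
    unfolding sum.distrib by (intro arg_cong2[where f = "(+)"] sum.cong refl) (auto simp: sum.delta)
  also have "\<dots> = (if l \<in> {3..n} then x 1 * y (l - 1) - x (l - 1) * y 1 else 0) +
     (if l \<in> {5..n} then x 2 * y (l - 2) - x (l - 2) * y 2 else 0)"
    unfolding sum.distrib by (subst (1 2) sum.delta) auto
  finally show ?thesis .
qed

lemma lie_of_basis_brackets_vectorspace:
  "vectorspace class_ring (lie_of_basis_brackets n c :: ('a::field, nat \<Rightarrow> 'a) lie_algebra)"
proof -
  let ?V = "lie_of_basis_brackets n c :: ('a, nat \<Rightarrow> 'a) lie_algebra"
  have "abelian_group ?V"
  proof (rule abelian_groupI)
    fix x assume "x \<in> carrier ?V"
    then show "\<exists>y\<in>carrier ?V. y \<oplus>\<^bsub>?V\<^esub> x = \<zero>\<^bsub>?V\<^esub>"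
      by (intro bexI[of _ "\<lambda>i. - x i"]) (auto simp: lie_of_basis_brackets_def)
  qed (auto simp: lie_of_basis_brackets_def algebra_simps)
  moreover have "cring (class_ring :: 'a ring)" "field (class_ring :: 'a ring)"
    by unfold_locales
  ultimately show ?thesis
    by (intro vectorspace.intro moduleI) (auto simp: lie_of_basis_brackets_def algebra_simps)
qed

lemma m0_lie_algebra: "lie_algebra class_ring (m0 n :: ('a::field, nat \<Rightarrow> 'a) lie_algebra)"
proof -
  let ?L = "m0 n :: ('a, nat \<Rightarrow> 'a) lie_algebra"
  interpret vectorspace class_ring ?L
    unfolding m0_def by (rule lie_of_basis_brackets_vectorspace)
  have sel: "carrier ?L = {x. \<forall>i. i \<notin> {1..n} \<longrightarrow> x i = 0}" "\<zero>\<^bsub>?L\<^esub> = (\<lambda>i. 0)"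
    "x \<oplus>\<^bsub>?L\<^esub> y = (\<lambda>i. x i + y i)" "a \<odot>\<^bsub>?L\<^esub> x = (\<lambda>i. a * x i)" for x y a
    by (simp_all add: m0_def lie_of_basis_brackets_def)
  have jacobi: "lie_bracket ?L x (lie_bracket ?L y z) l + lie_bracket ?L y (lie_bracket ?L z x) l
      + lie_bracket ?L z (lie_bracket ?L x y) l = 0" for x y z l
  proof -
    have "lie_bracket ?L u v 1 = 0" "lie_bracket ?L u v 2 = 0" for u v
      by (simp_all add: m0_bracket_coord)
    then show ?thesis
      by (simp add: m0_bracket_coord[of _ _ _ l] m0_bracket_coord[of _ _ _ "l - Suc 0"]) (auto simp: algebra_simps)
  qed
  show ?thesis
  proof (unfold_locales, unfold sel, goal_cases)
    case 1 then show ?case by (auto simp: m0_bracket_coord)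
  next
    case 2 then show ?case by (simp add: m0_bracket_coord fun_eq_iff) (simp add: algebra_simps)
  next
    case 3 then show ?case by (simp add: m0_bracket_coord fun_eq_iff) (simp add: algebra_simps)
  next
    case 4 then show ?case by (simp add: m0_bracket_coord fun_eq_iff) (simp add: algebra_simps)
  next
    case 5 then show ?case by (simp add: m0_bracket_coord fun_eq_iff) (simp add: algebra_simps)
  next
    case 6 then show ?case by (simp add: m0_bracket_coord fun_eq_iff)
  next
    case 7 show ?case by (simp only: jacobi)
  qed
qed

lemma m2_lie_algebra: "lie_algebra class_ring (m2 n :: ('a::field, nat \<Rightarrow> 'a) lie_algebra)"
proof -
  let ?L = "m2 n :: ('a, nat \<Rightarrow> 'a) lie_algebra"
  interpret vectorspace class_ring ?L
    unfolding m2_def by (rule lie_of_basis_brackets_vectorspace)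
  have sel: "carrier ?L = {x. \<forall>i. i \<notin> {1..n} \<longrightarrow> x i = 0}" "\<zero>\<^bsub>?L\<^esub> = (\<lambda>i. 0)"
    "x \<oplus>\<^bsub>?L\<^esub> y = (\<lambda>i. x i + y i)" "a \<odot>\<^bsub>?L\<^esub> x = (\<lambda>i. a * x i)" for x y a
    by (simp_all add: m2_def lie_of_basis_brackets_def)
  have jacobi: "lie_bracket ?L x (lie_bracket ?L y z) l + lie_bracket ?L y (lie_bracket ?L z x) l
      + lie_bracket ?L z (lie_bracket ?L x y) l = 0" for x y z l
  proof (cases "l \<in> {3..n}")
    case True
    have low: "lie_bracket ?L u v 1 = 0" "lie_bracket ?L u v 2 = 0" for u v
      by (simp_all add: m2_bracket_coord)
    consider "l = 3" | "l = 4" | "l = 5" | "l = 6" | p where "l = p + 7"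
    proof (cases "l < 7")
      case False
      then have "l = (l - 7) + 7" by simp
      then show ?thesis using that(5) by blast
    next
      case lt: True
      then have "l = 3 \<or> l = 4 \<or> l = 5 \<or> l = 6" using True by auto
      then show ?thesis using that(1-4) by blast
    qed
    then show ?thesis
    proof cases
      case 1
      have e3: "lie_bracket ?L u v 3 = u 1 * v 2 - u 2 * v 1" for u v
        using True 1 by (simp_all add: m2_bracket_coord)
      show ?thesis
        unfolding 1 e3 low by (simp add: algebra_simps)
    next
      case 2
      have e4: "lie_bracket ?L u v 4 = u 1 * v 3 - u 3 * v 1" and e3: "lie_bracket ?L u v 3 = u 1 * v 2 - u 2 * v 1" for u v
        using True 2 by (simp_all add: m2_bracket_coord)
      show ?thesis
        unfolding 2 e4 e3 low by (simp add: algebra_simps)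
    next
      case 3
      have e5: "lie_bracket ?L u v 5 = u 1 * v 4 - u 4 * v 1 + (u 2 * v 3 - u 3 * v 2)" and e4: "lie_bracket ?L u v 4 = u 1 * v 3 - u 3 * v 1" and e3: "lie_bracket ?L u v 3 = u 1 * v 2 - u 2 * v 1" for u v
        using True 3 by (simp_all add: m2_bracket_coord)
      show ?thesis
        unfolding 3 e5 e4 e3 low by (simp add: algebra_simps)
    next
      case 4
      have e6: "lie_bracket ?L u v 6 = u 1 * v 5 - u 5 * v 1 + (u 2 * v 4 - u 4 * v 2)" and e5: "lie_bracket ?L u v 5 = u 1 * v 4 - u 4 * v 1 + (u 2 * v 3 - u 3 * v 2)" and e4: "lie_bracket ?L u v 4 = u 1 * v 3 - u 3 * v 1" for u v
        using True 4 by (simp_all add: m2_bracket_coord)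
      show ?thesis
        unfolding 4 e6 e5 e4 low by (simp add: algebra_simps)
    next
      case 5
      have e7: "lie_bracket ?L u v (p + 7) =
          u 1 * v (p + 6) - u (p + 6) * v 1 + (u 2 * v (p + 5) - u (p + 5) * v 2)"
        and e6: "lie_bracket ?L u v (p + 6) =
          u 1 * v (p + 5) - u (p + 5) * v 1 + (u 2 * v (p + 4) - u (p + 4) * v 2)"
        and e5: "lie_bracket ?L u v (p + 5) =
          u 1 * v (p + 4) - u (p + 4) * v 1 + (u 2 * v (p + 3) - u (p + 3) * v 2)" for u v
        using True 5 by (simp_all add: m2_bracket_coord add.commute)
      show ?thesis
        unfolding 5 e7 e6 e5 low by (simp add: algebra_simps)
    qed
  next
    case False
    then have "lie_bracket ?L u v l = 0" for u v
      by (auto simp: m2_bracket_coord)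
    then show ?thesis by simp
  qed
  show ?thesis
  proof (unfold_locales, unfold sel, goal_cases)
    case 1 then show ?case by (auto simp: m2_bracket_coord)
  next
    case 2 then show ?case by (simp add: m2_bracket_coord fun_eq_iff) (simp add: algebra_simps)
  next
    case 3 then show ?case by (simp add: m2_bracket_coord fun_eq_iff) (simp add: algebra_simps)
  next
    case 4 then show ?case by (simp add: m2_bracket_coord fun_eq_iff) (simp add: algebra_simps)
  next
    case 5 then show ?case by (simp add: m2_bracket_coord fun_eq_iff) (simp add: algebra_simps)
  next
    case 6 then show ?case by (simp add: m2_bracket_coord fun_eq_iff)
  next
    case 7 show ?case by (simp only: jacobi)
  qed
qed

end

theory Submission
  imports Defs
begin

text \<open>Let \<open>D\<close> be the derivation of the exterior algebra on \<open>e\<^sup>1,\<dots>,e\<^sup>n\<close> that is dual to \<open>ad e\<^sub>1\<close>, so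
  \<open>D e\<^sup>i = e\<^sup>i\<^sup>-\<^sup>1\<close> for \<open>i \<ge> 3\<close> and \<open>D e\<^sup>1 = D e\<^sup>2 = 0\<close>. In characteristic two \<open>D\<^sup>2\<close> is again a
  derivation, and the differentials of \<open>\<mm>\<^sub>0(n)\<close> and \<open>\<mm>\<^sub>2(n)\<close> are \<open>d\<^sub>0 = e\<^sup>1 \<and> D\<close> and
  \<open>d\<^sub>2 = e\<^sup>1 \<and> D + e\<^sup>2 \<and> D\<^sup>2\<close>. With \<open>\<iota>\<close> the contraction by \<open>e\<^sub>1\<close>, the map \<open>T w = w + e\<^sup>2 \<and> D (\<iota> w)\<close> is an
  involution, and \<open>d\<^sub>2 T = e\<^sup>1 \<and> D + e\<^sup>2 \<and> D\<^sup>2 + e\<^sup>1 \<and> e\<^sup>2 \<and> D\<^sup>2 \<iota> = T d\<^sub>0\<close>. Hence the two cochain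
  complexes are isomorphic.\<close>

section \<open>Dimensions of quotient modules\<close>

text \<open>Evaluates the raw set operations of the quotient on representatives, so that its vector
  space axioms reduce to those of \<open>V\<close>.\<close>

lemma quotient_module_coset_ops:
  assumes "subspace K W V"
  shows "\<And>x y. \<lbrakk>x \<in> carrier V; y \<in> carrier V\<rbrakk> \<Longrightarrow>
      (W +>\<^bsub>V\<^esub> x) \<oplus>\<^bsub>quotient_module V W\<^esub> (W +>\<^bsub>V\<^esub> y) = W +>\<^bsub>V\<^esub> (x \<oplus>\<^bsub>V\<^esub> y)"
    and "\<And>a x. \<lbrakk>a \<in> carrier K; x \<in> carrier V\<rbrakk> \<Longrightarrow>
      a \<odot>\<^bsub>quotient_module V W\<^esub> (W +>\<^bsub>V\<^esub> x) = W +>\<^bsub>V\<^esub> (a \<odot>\<^bsub>V\<^esub> x)"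
    and "W +>\<^bsub>V\<^esub> \<zero>\<^bsub>V\<^esub> = W"
    and "carrier (quotient_module V W) = (\<lambda>x. W +>\<^bsub>V\<^esub> x) ` carrier V"
    and "abelian_subgroup W V"
proof -
  interpret vectorspace K V using assms by (simp add: subspace_def)
  interpret W: LinearCombinations.submodule K W V using assms by (simp add: subspace_def)
  have sub: "additive_subgroup W V"
  proof (intro additive_subgroup.intro subgroup.intro)
    fix x assume x: "x \<in> W"
    \<comment> \<open>Closure under negation is obtained from closure under scalars, negation being
      multiplication by -1.\<close>
    then have "inv\<^bsub>add_monoid V\<^esub> x = (\<ominus>\<^bsub>K\<^esub> \<one>\<^bsub>K\<^esub>) \<odot>\<^bsub>V\<^esub> x"
      using W.subset smult_minus_1[of x] by (auto simp: a_inv_def)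
    then show "inv\<^bsub>add_monoid V\<^esub> x \<in> W" using x by simp
  qed (use W.subset in auto)
  show WV: "abelian_subgroup W V"
    by (rule abelian_subgroupI3[OF sub abelian_group_axioms])
  then interpret W: abelian_subgroup W V .
  show "W +>\<^bsub>V\<^esub> \<zero>\<^bsub>V\<^esub> = W" using W.a_subset by simp
  show "carrier (quotient_module V W) = (\<lambda>x. W +>\<^bsub>V\<^esub> x) ` carrier V"
    by (auto simp: quotient_module_def A_RCOSETS_def')
  show "(W +>\<^bsub>V\<^esub> x) \<oplus>\<^bsub>quotient_module V W\<^esub> (W +>\<^bsub>V\<^esub> y) = W +>\<^bsub>V\<^esub> (x \<oplus>\<^bsub>V\<^esub> y)"
    if "x \<in> carrier V" "y \<in> carrier V" for x y
    using that by (simp add: quotient_module_def W.a_rcos_sum)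
  show "a \<odot>\<^bsub>quotient_module V W\<^esub> (W +>\<^bsub>V\<^esub> x) = W +>\<^bsub>V\<^esub> (a \<odot>\<^bsub>V\<^esub> x)"
    if a: "a \<in> carrier K" and x: "x \<in> carrier V" for a x
  proof -
    have "W +>\<^bsub>V\<^esub> (a \<odot>\<^bsub>V\<^esub> y) = W +>\<^bsub>V\<^esub> (a \<odot>\<^bsub>V\<^esub> x)" if "y \<in> W +>\<^bsub>V\<^esub> x" for y
    proof -
      from that obtain w where w: "w \<in> W" "y = w \<oplus>\<^bsub>V\<^esub> x" by (auto simp: a_r_coset_def')
      then have "a \<odot>\<^bsub>V\<^esub> y = a \<odot>\<^bsub>V\<^esub> w \<oplus>\<^bsub>V\<^esub> a \<odot>\<^bsub>V\<^esub> x"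
        using a x W.a_subset by (auto simp: smult_r_distr)
      then have "a \<odot>\<^bsub>V\<^esub> y \<in> W +>\<^bsub>V\<^esub> (a \<odot>\<^bsub>V\<^esub> x)"
        using a w by (auto simp: a_r_coset_def')
      then show ?thesis using a x 
        by (intro a_repr_independence[symmetric] additive_subgroup.a_subgroup sub) auto
    qed
    moreover have "x \<in> W +>\<^bsub>V\<^esub> x" using x by (rule W.a_rcos_self)
    ultimately have "(\<Union>y\<in>W +>\<^bsub>V\<^esub> x. W +>\<^bsub>V\<^esub> (a \<odot>\<^bsub>V\<^esub> y)) = W +>\<^bsub>V\<^esub> (a \<odot>\<^bsub>V\<^esub> x)"
      by blast
    then show ?thesis by (simp add: quotient_module_def)
  qed
qed

lemma quotient_module_vectorspace:
  assumes "subspace K W V"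
  shows "vectorspace K (quotient_module V W)"
proof -
  interpret vectorspace K V using assms by (simp add: subspace_def)
  note ops = quotient_module_coset_ops(1-4)[OF assms]
  interpret W: abelian_subgroup W V by (rule quotient_module_coset_ops(5)[OF assms])
  let ?Q = "quotient_module V W"
  have zero: "\<zero>\<^bsub>?Q\<^esub> = W +>\<^bsub>V\<^esub> \<zero>\<^bsub>V\<^esub>" unfolding ops(3) by (simp add: quotient_module_def)
  have "abelian_group ?Q"
  proof (rule abelian_groupI)
    fix X assume "X \<in> carrier ?Q"
    then obtain x where "x \<in> carrier V" "X = W +>\<^bsub>V\<^esub> x" by (auto simp: ops)
    then show "\<exists>Y\<in>carrier ?Q. Y \<oplus>\<^bsub>?Q\<^esub> X = \<zero>\<^bsub>?Q\<^esub>"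
      by (intro bexI[of _ "W +>\<^bsub>V\<^esub> (\<ominus>\<^bsub>V\<^esub> x)"]) (auto simp: ops zero M.l_neg)
  qed (auto simp: ops(1,4) zero M.a_assoc, auto simp: M.a_comm)
  then show ?thesis
    by (intro vectorspace.intro moduleI R.is_cring field_axioms)
      (auto simp: ops(1,2,4) smult_l_distr smult_r_distr smult_assoc1)
qed

text \<open>No finiteness is assumed, which spares a proof that the spaces of forms are
  finite-dimensional.\<close>

lemma linear_bij_dim_eq:
  assumes V: "vectorspace K V" and V': "vectorspace K V'"
    and T: "T \<in> LinearCombinations.module_hom K V V'" and bij: "bij_betw T (carrier V) (carrier V')"
  shows "vectorspace.dim K V = vectorspace.dim K V'"
proof -
  interpret V: vectorspace K V by (rule V)
  interpret V': vectorspace K V' by (rule V')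
  interpret T: linear_map K V V' T
    using T by unfold_locales
  define S where "S = inv_into (carrier V) T"
  have inj: "inj_on T (carrier V)" and im: "T ` carrier V = carrier V'"
    using bij by (auto simp: bij_betw_def)
  have S: "S y \<in> carrier V" "T (S y) = y" if "y \<in> carrier V'" for y
    using that im by (auto simp: S_def inv_into_into f_inv_into_f)
  have "S \<in> LinearCombinations.module_hom K V' V"
    unfolding LinearCombinations.module_hom_def using S by (auto intro!: inj_onD[OF inj])
  then interpret S: linear_map K V' V S
    by unfold_locales
  have imS: "S ` carrier V' = carrier V"
    unfolding S_def by (rule bij_betw_imp_surj_on[OF bij_betw_inv_into[OF bij]])
  show ?thesis
  proof (cases "V.fin_dim")
    case True
    then show ?thesis by (rule T.dim_eq[OF _ inj im])
  next
    \<comment> \<open>\<open>dim\<close> is the least size of a finite generating set. If neither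
      space has one, both defining predicates are constantly false and the two default values
      agree.\<close>
    case False
    then have "\<not> V'.fin_dim" using S.surj_fin_dim[OF _ imS] by blast
    then have "(\<lambda>n. \<exists>A. finite A \<and> card A = n \<and> A \<subseteq> carrier V \<and> V.gen_set A) =
      (\<lambda>n. \<exists>A. finite A \<and> card A = n \<and> A \<subseteq> carrier V' \<and> V'.gen_set A)"
      using False unfolding V.fin_dim_def V'.fin_dim_def by (intro ext) blast
    then show ?thesis unfolding V.dim_def V'.dim_def by simp
  qed
qed

text \<open>The induced map sends a coset to its image under \<open>T\<close>, so no representatives
  are chosen. It is injective because \<open>T\<close> is injective on the carrier, which contains
  every coset.\<close>

lemma dim_quotient_module_eq:
  assumes W: "subspace K W V" and W': "subspace K W' V'"
    and T: "T \<in> LinearCombinations.module_hom K V V'" and bij: "bij_betw T (carrier V) (carrier V')"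
    and TW: "T ` W = W'"
  shows "vectorspace.dim K (quotient_module V W) = vectorspace.dim K (quotient_module V' W')"
proof (rule linear_bij_dim_eq)
  note ops = quotient_module_coset_ops(1,2,4)[OF W] and ops' = quotient_module_coset_ops(1,2,4)[OF W']
  interpret vectorspace K V using W by (simp add: subspace_def)
  interpret W: LinearCombinations.submodule K W V using W by (simp add: subspace_def)
  have Tc: "T x \<in> carrier V'" if "x \<in> carrier V" for x
    using T that by (auto simp: LinearCombinations.module_hom_def)
  have img: "T ` (W +>\<^bsub>V\<^esub> x) = W' +>\<^bsub>V'\<^esub> T x" if x: "x \<in> carrier V" for x
  proof -
    have "T (w \<oplus>\<^bsub>V\<^esub> x) = T w \<oplus>\<^bsub>V'\<^esub> T x" if "w \<in> W" for w
      using x that W.subset LinearCombinations.module_hom_add[OF T] by blast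
    then show ?thesis unfolding a_r_coset_def' TW[symmetric] by (auto simp: image_iff)
  qed
  show "(`) T \<in> LinearCombinations.module_hom K (quotient_module V W) (quotient_module V' W')"
    unfolding LinearCombinations.module_hom_def mem_Collect_eq ops(3) ops'(3)
  proof (intro conjI allI impI Pi_I; (elim conjE imageE)?)
    show "T ` X \<in> (+>\<^bsub>V'\<^esub>) W' ` carrier V'" if "X = W +>\<^bsub>V\<^esub> x" "x \<in> carrier V" for X x
      using that by (simp add: img Tc)
  qed (simp_all add: ops ops' img Tc LinearCombinations.module_hom_add[OF T]
      LinearCombinations.module_hom_smult[OF T])
  have sub: "X \<subseteq> carrier V" if "X \<in> carrier (quotient_module V W)" for X
    using that W.subset by (auto simp: ops a_r_coset_def')
  show "bij_betw ((`) T) (carrier (quotient_module V W)) (carrier (quotient_module V' W'))"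
    unfolding bij_betw_def
  proof
    show "inj_on ((`) T) (carrier (quotient_module V W))"
      using sub bij by (auto intro!: inj_onI simp: bij_betw_def inj_on_image_eq_iff)
    show "(`) T ` carrier (quotient_module V W) = carrier (quotient_module V' W')"
    proof -
      have "(`) T ` (\<lambda>x. W +>\<^bsub>V\<^esub> x) ` carrier V = (\<lambda>x. W' +>\<^bsub>V'\<^esub> x) ` T ` carrier V"
        unfolding image_image by (rule image_cong) (simp_all add: img)
      then show ?thesis using bij by (simp add: ops(3) ops'(3) bij_betw_def)
    qed
  qed
qed (rule quotient_module_vectorspace W W')+


section \<open>Alternating forms as functions on lists\<close>

lemma alternating_formsI:
  fixes w :: "'b list \<Rightarrow> 'a::field"
  assumes "\<And>xs. xs \<notin> tuples V k \<Longrightarrow> w xs = 0"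
    and "\<And>ps qs x y. \<lbrakk>x \<in> carrier V; y \<in> carrier V\<rbrakk> \<Longrightarrow>
      w (ps @ (x \<oplus>\<^bsub>V\<^esub> y) # qs) = w (ps @ x # qs) + w (ps @ y # qs)"
    and "\<And>ps qs a x. x \<in> carrier V \<Longrightarrow> w (ps @ (a \<odot>\<^bsub>V\<^esub> x) # qs) = a * w (ps @ x # qs)"
    and "\<And>ps qs rs x. w (ps @ x # qs @ x # rs) = 0"
  shows "w \<in> alternating_forms V k"
  unfolding alternating_forms_def tuples_def
  using assms
  by (auto simp: upd_conv_take_nth_drop tuples_def dest!: not_distinct_decomp)

text \<open>Both sides vanish off the tuples, so the laws hold for arbitrary surrounding lists.
  Inductions over \<open>ps\<close> then carry no length or membership conditions.\<close>

lemma alternating_formsD: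
  fixes w :: "'b list \<Rightarrow> 'a::field"
  assumes V: "vectorspace class_ring V" and w: "w \<in> alternating_forms V k"
  shows "\<And>xs. xs \<notin> tuples V k \<Longrightarrow> w xs = 0"
    and "\<And>ps qs x y. \<lbrakk>x \<in> carrier V; y \<in> carrier V\<rbrakk> \<Longrightarrow>
      w (ps @ (x \<oplus>\<^bsub>V\<^esub> y) # qs) = w (ps @ x # qs) + w (ps @ y # qs)"
    and "\<And>ps qs a x. x \<in> carrier V \<Longrightarrow> w (ps @ (a \<odot>\<^bsub>V\<^esub> x) # qs) = a * w (ps @ x # qs)"
    and "\<And>ps qs rs x. w (ps @ x # qs @ x # rs) = 0"
proof -
  interpret vectorspace class_ring V by (rule V)
  show off: "w xs = 0" if "xs \<notin> tuples V k" for xs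
    using that w by (simp add: alternating_forms_def)
  show "w (ps @ x # qs @ x # rs) = 0" for ps qs rs x
    using w off by (cases "ps @ x # qs @ x # rs \<in> tuples V k") (auto simp: alternating_forms_def)
  have upd: "(ps @ z # qs)[length ps := y] = ps @ y # qs" for ps qs y and z :: 'b
    by simp
  show "w (ps @ (x \<oplus>\<^bsub>V\<^esub> y) # qs) = w (ps @ x # qs) + w (ps @ y # qs)"
    if xy: "x \<in> carrier V" "y \<in> carrier V" for ps qs x y
  proof (cases "ps @ x # qs \<in> tuples V k")
    case True
    then have "length ps < k" by (auto simp: tuples_def)
    then have "w ((ps @ x # qs)[length ps := x \<oplus>\<^bsub>V\<^esub> y]) =
        w ((ps @ x # qs)[length ps := x]) + w ((ps @ x # qs)[length ps := y])"
      using w xy True unfolding alternating_forms_def by blast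
    then show ?thesis by (simp only: upd)
  next
    case False
    then show ?thesis using xy by (subst (1 2 3) off) (auto simp: tuples_def)
  qed
  show "w (ps @ (a \<odot>\<^bsub>V\<^esub> x) # qs) = a * w (ps @ x # qs)" if x: "x \<in> carrier V" for ps qs a x
  proof (cases "ps @ x # qs \<in> tuples V k")
    case True
    then have "length ps < k" by (auto simp: tuples_def)
    then have "w ((ps @ x # qs)[length ps := a \<odot>\<^bsub>V\<^esub> x]) = a * w ((ps @ x # qs)[length ps := x])"
      using w x True unfolding alternating_forms_def by blast
    then show ?thesis by (simp only: upd)
  next
    case False
    then show ?thesis using x by (subst (1 2) off) (auto simp: tuples_def)
  qed
qed

text \<open>This is the interior product with \<open>x\<close>; it is the zero form when
  \<open>x\<close> lies outside the carrier.\<close>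

lemma alternating_forms_contract:
  fixes w :: "'b list \<Rightarrow> 'a::field"
  assumes V: "vectorspace class_ring V" and w: "w \<in> alternating_forms V (Suc k)"
  shows "(\<lambda>xs. w (x # xs)) \<in> alternating_forms V k"
  using alternating_formsD(2-4)[OF V w, where ps = "x # ps" for ps]
    alternating_formsD(1)[OF V w]
  by (intro alternating_formsI) (auto simp: tuples_def)

lemma alternating_forms_zero: "(\<lambda>xs. 0) \<in> alternating_forms V k"
  by (simp add: alternating_forms_def)

lemma alternating_forms_add:
  "\<lbrakk>v \<in> alternating_forms V k; w \<in> alternating_forms V k\<rbrakk> \<Longrightarrow>
   (\<lambda>xs. v xs + w xs) \<in> alternating_forms V k"
  by (auto simp: alternating_forms_def distrib_left)

lemma alternating_forms_smult:
  "w \<in> alternating_forms V k \<Longrightarrow> (\<lambda>xs. a * w xs) \<in> alternating_forms V k"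
  by (auto simp: alternating_forms_def distrib_left mult.left_commute)

lemma coboundary_linear:
  "coboundary L k (\<lambda>xs. v xs + w xs) = (\<lambda>xs. coboundary L k v xs + coboundary L k w xs)"
  "coboundary L k (\<lambda>xs. a * w xs) = (\<lambda>xs. a * coboundary L k w xs)"
  by (auto simp: coboundary_def sum.distrib distrib_left sum_distrib_left mult.left_commute
      intro!: ext sum.cong)

section \<open>Isomorphic cochain complexes\<close>

lemma cochains_restrict_vectorspace:
  fixes L :: "('a::field, 'b, 'm) lie_algebra_scheme"
  assumes "(\<lambda>xs. 0) \<in> S" "\<And>v w. \<lbrakk>v \<in> S; w \<in> S\<rbrakk> \<Longrightarrow> (\<lambda>xs. v xs + w xs) \<in> S"
    and smult: "\<And>a w. w \<in> S \<Longrightarrow> (\<lambda>xs. a * w xs) \<in> S"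
  shows "vectorspace class_ring ((cochains L k)\<lparr>carrier := S\<rparr>)"
proof -
  let ?V = "(cochains L k)\<lparr>carrier := S\<rparr>"
  have "abelian_group ?V"
  proof (rule abelian_groupI)
    fix w assume "w \<in> carrier ?V"
    then show "\<exists>v\<in>carrier ?V. v \<oplus>\<^bsub>?V\<^esub> w = \<zero>\<^bsub>?V\<^esub>"
      using smult[of w "- 1"] by (intro bexI[of _ "\<lambda>xs. - w xs"]) (auto simp: cochains_def)
  qed (use assms in \<open>auto simp: cochains_def algebra_simps\<close>)
  moreover have "cring (class_ring :: 'a ring)" "field (class_ring :: 'a ring)"
    by unfold_locales
  ultimately show ?thesis
    using smult by (intro vectorspace.intro moduleI) (auto simp: cochains_def algebra_simps)
qed

lemma coboundaries_subspace_cocycles: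
  fixes L :: "('a::field, 'b, 'm) lie_algebra_scheme"
  assumes closed: "\<And>k w. w \<in> alternating_forms L k \<Longrightarrow>
      coboundary L k w \<in> alternating_forms L (Suc k)"
    and square: "\<And>k w. w \<in> alternating_forms L k \<Longrightarrow>
      coboundary L (Suc k) (coboundary L k w) = (\<lambda>xs. 0)"
  shows "subspace class_ring (coboundaries L k) ((cochains L k)\<lparr>carrier := cocycles L k\<rparr>)"
proof -
  have zero: "coboundary L k (\<lambda>xs. 0) = (\<lambda>xs. 0)" for k
    by (auto simp: coboundary_def)
  let ?V = "(cochains L k)\<lparr>carrier := cocycles L k\<rparr>"
  have vs: "vectorspace class_ring ?V"
    by (rule cochains_restrict_vectorspace)
      (auto simp: cocycles_def zero coboundary_linear alternating_forms_zero
        alternating_forms_add alternating_forms_smult)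
  have sub: "coboundaries L k \<subseteq> cocycles L k"
    using closed square
    by (auto simp: coboundaries_def cocycles_def zero alternating_forms_zero split: nat.split)
  have z: "(\<lambda>xs. 0) \<in> coboundaries L k"
  proof (cases k)
    case (Suc j)
    then show ?thesis using alternating_forms_zero[of L j] zero[of j]
      by (auto simp: coboundaries_def image_iff intro!: bexI)
  qed (simp add: coboundaries_def)
  have add: "(\<lambda>xs. v xs + w xs) \<in> coboundaries L k"
    if vw: "v \<in> coboundaries L k" "w \<in> coboundaries L k" for v w
  proof (cases k)
    case (Suc j)
    with vw obtain v' w' where "v' \<in> alternating_forms L j" "v = coboundary L j v'"
      "w' \<in> alternating_forms L j" "w = coboundary L j w'" by (auto simp: coboundaries_def)
    then show ?thesis using Suc coboundary_linear(1)[of L j v' w']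
      by (auto simp: coboundaries_def image_iff intro!: bexI[OF _ alternating_forms_add[of v' L j w']])
  qed (use vw in \<open>simp add: coboundaries_def\<close>)
  have smult: "(\<lambda>xs. a * w xs) \<in> coboundaries L k" if w: "w \<in> coboundaries L k" for a w
  proof (cases k)
    case (Suc j)
    with w obtain w' where "w' \<in> alternating_forms L j" "w = coboundary L j w'"
      by (auto simp: coboundaries_def)
    then show ?thesis using Suc coboundary_linear(2)[of L j a w']
      by (auto simp: coboundaries_def image_iff intro!: bexI[OF _ alternating_forms_smult[of w' L j a]])
  qed (use w in \<open>simp add: coboundaries_def\<close>)
  show ?thesis
    unfolding subspace_def
    by (intro conjI vs LinearCombinations.submodule.intro vectorspace.axioms(1)[OF vs])
      (use sub z add smult in \<open>auto simp: cochains_def\<close>)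
qed

text \<open>Since \<open>T\<close> is its own inverse, intertwining gives d' = T d T, and therefore
  d' inherits degree and square zero from d. Forms are functions on lists, so a single
  \<open>T\<close> serves all degrees.\<close>

lemma betti_eq_if_cochain_involution:
  fixes L :: "('a::field, 'b, 'm) lie_algebra_scheme" and L' :: "('a, 'b, 'n) lie_algebra_scheme"
    and T :: "('b list \<Rightarrow> 'a) \<Rightarrow> 'b list \<Rightarrow> 'a"
  assumes same: "\<And>k. alternating_forms L' k = alternating_forms L k"
    and closed: "\<And>k w. w \<in> alternating_forms L k \<Longrightarrow>
      coboundary L k w \<in> alternating_forms L (Suc k)"
    and square: "\<And>k w. w \<in> alternating_forms L k \<Longrightarrow>
      coboundary L (Suc k) (coboundary L k w) = (\<lambda>xs. 0)"
    and T_alt: "\<And>k w. w \<in> alternating_forms L k \<Longrightarrow> T w \<in> alternating_forms L k"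
    and T_add: "\<And>v w. T (\<lambda>xs. v xs + w xs) = (\<lambda>xs. T v xs + T w xs)"
    and T_smult: "\<And>a w. T (\<lambda>xs. a * w xs) = (\<lambda>xs. a * T w xs)"
    and T_T: "\<And>w. T (T w) = w"
    and T_coboundary: "\<And>k w. w \<in> alternating_forms L k \<Longrightarrow>
      coboundary L' k (T w) = T (coboundary L k w)"
  shows "betti L k = betti L' k"
proof -
  have T0: "T (\<lambda>xs. 0) = (\<lambda>xs. 0)" using T_smult[of 0 "\<lambda>xs. 0"] by simp
  have cob': "coboundary L' k w = T (coboundary L k (T w))" if "w \<in> alternating_forms L k" for k w
    using T_coboundary[OF T_alt[OF that]] by (simp add: T_T)
  have sub: "subspace class_ring (coboundaries L k) ((cochains L k)\<lparr>carrier := cocycles L k\<rparr>)"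
    by (rule coboundaries_subspace_cocycles[OF closed square])
  have sub': "subspace class_ring (coboundaries L' k) ((cochains L' k)\<lparr>carrier := cocycles L' k\<rparr>)"
    by (rule coboundaries_subspace_cocycles)
      (simp_all add: same cob' closed square T_alt T_T T0)
  have cocycle: "T w \<in> cocycles L' k" if "w \<in> cocycles L k" for w
    using that by (simp add: cocycles_def same T_alt T_coboundary T0)
  have cocycle': "T w \<in> cocycles L k" if w: "w \<in> cocycles L' k" for w
  proof -
    have alt: "w \<in> alternating_forms L k" and "coboundary L' k w = (\<lambda>xs. 0)"
      using w by (simp_all add: cocycles_def same)
    \<comment> \<open>The cocycle condition reads T (d (T w)) = 0; a further \<open>T\<close> leaves
      d (T w) = 0.\<close>
    then have "T (T (coboundary L k (T w))) = T (\<lambda>xs. 0)"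
      by (simp add: cob'[OF alt])
    then show ?thesis using alt by (simp add: cocycles_def T_T T0 T_alt)
  qed
  show ?thesis
    unfolding betti_def cohomology_def
  proof (rule dim_quotient_module_eq[OF sub sub'])
    show "T \<in> LinearCombinations.module_hom class_ring
        ((cochains L k)\<lparr>carrier := cocycles L k\<rparr>) ((cochains L' k)\<lparr>carrier := cocycles L' k\<rparr>)"
      by (auto simp: LinearCombinations.module_hom_def cochains_def cocycle T_add T_smult)
    show "bij_betw T (carrier ((cochains L k)\<lparr>carrier := cocycles L k\<rparr>))
        (carrier ((cochains L' k)\<lparr>carrier := cocycles L' k\<rparr>))"
      by (rule bij_betw_byWitness[where f' = T]) (auto simp: T_T cocycle cocycle')
    show "T ` coboundaries L k = coboundaries L' k"
    proof (cases k)
      case (Suc j)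
      have "T ` alternating_forms L j = alternating_forms L j"
        using T_alt T_T by (auto simp: image_iff intro!: bexI[of _ "T _"])
      then have "coboundary L' j ` alternating_forms L j =
          (\<lambda>w. coboundary L' j (T w)) ` alternating_forms L j"
        by (metis image_image)
      also have "\<dots> = T ` coboundary L j ` alternating_forms L j"
        unfolding image_image by (rule image_cong) (simp_all add: T_coboundary)
      finally show ?thesis using Suc by (simp add: coboundaries_def same)
    qed (simp add: coboundaries_def T0)
  qed
qed


section \<open>Wedge products and derivations\<close>

text \<open>In characteristic two the wedge product with a covector and the derivation of the exterior
  algebra that is dual to an endomorphism need no signs. Contraction with the first argument turns
  their usual Leibniz rules into these recursions.\<close>

fun wedge :: "('b \<Rightarrow> 'a::comm_semiring_1) \<Rightarrow> ('b list \<Rightarrow> 'a) \<Rightarrow> 'b list \<Rightarrow> 'a" where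
  "wedge f w [] = 0"
| "wedge f w (x # xs) = f x * w xs + wedge f (\<lambda>ys. w (x # ys)) xs"

fun deriv_act :: "('b \<Rightarrow> 'b) \<Rightarrow> ('b list \<Rightarrow> 'a::comm_semiring_1) \<Rightarrow> 'b list \<Rightarrow> 'a" where
  "deriv_act A w [] = 0"
| "deriv_act A w (x # xs) = w (A x # xs) + deriv_act A (\<lambda>ys. w (x # ys)) xs"

lemma wedge_linear:
  "wedge f (\<lambda>xs. v xs + w xs) xs = wedge f v xs + wedge f w xs"
  "wedge f (\<lambda>xs. a * w xs) xs = a * wedge f w xs"
  "wedge f (\<lambda>xs. 0) xs = 0"
  by (induction xs arbitrary: v w) (simp_all add: algebra_simps)

lemma deriv_act_linear:
  "deriv_act A (\<lambda>xs. v xs + w xs) xs = deriv_act A v xs + deriv_act A w xs"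
  "deriv_act A (\<lambda>xs. a * w xs) xs = a * deriv_act A w xs"
  "deriv_act A (\<lambda>xs. 0) xs = 0"
  by (induction xs arbitrary: v w) (simp_all add: algebra_simps)

lemmas deriv_act_linear_fun = deriv_act_linear[abs_def]

text \<open>The Leibniz rule D (f \<and> w) = (f o A) \<and> w + f \<and> D w, whose first term
  vanishes by assumption.\<close>

lemma deriv_act_wedge:
  assumes "\<And>x. f (A x) = 0"
  shows "deriv_act A (wedge f w) = wedge f (deriv_act A w)"
proof
  fix xs
  show "deriv_act A (wedge f w) xs = wedge f (deriv_act A w) xs"
    by (induction xs arbitrary: w) (simp_all add: assms wedge_linear deriv_act_linear add_ac)
qed

section \<open>Support and linearity in single slots\<close>

lemma wedge_notin_tuples:
  assumes "\<And>xs. xs \<notin> tuples V k \<Longrightarrow> w xs = 0" "\<And>x. x \<notin> carrier V \<Longrightarrow> f x = 0"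
    and "xs \<notin> tuples V (Suc k)"
  shows "wedge f w xs = 0"
  using assms
proof (induction xs arbitrary: w k)
  case (Cons x xs)
  have "wedge f (\<lambda>ys. w (x # ys)) xs = 0"
  proof (cases "k = 0 \<or> x \<notin> carrier V")
    \<comment> \<open>Here contraction with \<open>x\<close> is identically zero. Degree 0 is
      separate because the induction hypothesis would need degree -1.\<close>
    case True
    then have "w (x # ys) = 0" for ys using Cons.prems(1) by (auto simp: tuples_def)
    then show ?thesis by (simp add: wedge_linear)
  next
    case False
    then obtain j where j: "k = Suc j" by (cases k) auto
    show ?thesis
      by (rule Cons.IH[of j]) (use False j Cons.prems in \<open>auto simp: tuples_def\<close>)
  qed
  moreover have "f x * w xs = 0"
    using Cons.prems by (cases "x \<in> carrier V") (auto simp: tuples_def)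
  ultimately show ?case by simp
qed simp

text \<open>The condition on \<open>A\<close> keeps it from moving a stray entry back into the
  carrier.\<close>

lemma deriv_act_notin_tuples:
  assumes "\<And>xs. xs \<notin> tuples V k \<Longrightarrow> w xs = 0" "\<And>x. x \<notin> carrier V \<Longrightarrow> A x \<notin> carrier V"
    and "xs \<notin> tuples V k"
  shows "deriv_act A w xs = 0"
  using assms
proof (induction xs arbitrary: w k)
  case (Cons x xs)
  have "deriv_act A (\<lambda>ys. w (x # ys)) xs = 0"
  proof (cases "k = 0 \<or> x \<notin> carrier V")
    case True
    then have "w (x # ys) = 0" for ys using Cons.prems(1) by (auto simp: tuples_def)
    then show ?thesis by (simp add: deriv_act_linear)
  next
    case False
    then obtain j where j: "k = Suc j" by (cases k) auto
    show ?thesis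
      by (rule Cons.IH[of j]) (use False j Cons.prems in \<open>auto simp: tuples_def\<close>)
  qed
  moreover have "w (A x # xs) = 0"
    using Cons.prems by (cases "x \<in> carrier V") (auto simp: tuples_def)
  ultimately show ?case by simp
qed simp

text \<open>The vectors \<open>x\<close>, \<open>y\<close>, \<open>z\<close> are fixed while
  \<open>ps\<close> and \<open>qs\<close> range over all lists, so the hypothesis passes to every
  contraction of \<open>w\<close> and the induction needs neither a carrier nor a degree.\<close>

lemma wedge_add_slot:
  assumes "\<And>ps qs. w (ps @ z # qs) = w (ps @ x # qs) + w (ps @ y # qs)" "f z = f x + f y"
  shows "wedge f w (ps @ z # qs) = wedge f w (ps @ x # qs) + wedge f w (ps @ y # qs)"
  using assms(1)
proof (induction ps arbitrary: w)
  case Nil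
  from Nil[of "[]"] assms(2) show ?case by (simp add: wedge_linear algebra_simps)
next
  case (Cons p ps)
  have "wedge f (\<lambda>ys. w (p # ys)) (ps @ z # qs) = wedge f (\<lambda>ys. w (p # ys)) (ps @ x # qs) +
      wedge f (\<lambda>ys. w (p # ys)) (ps @ y # qs)"
    by (rule Cons.IH) (use Cons.prems[of "p # ps" for ps] in simp)+
  moreover have "w (ps @ z # qs) = w (ps @ x # qs) + w (ps @ y # qs)"
    using Cons.prems[of ps] by simp
  ultimately show ?case by (simp add: add_ac distrib_left)
qed

lemma wedge_smult_slot:
  assumes "\<And>ps qs. w (ps @ z # qs) = a * w (ps @ x # qs)" "f z = a * f x"
  shows "wedge f w (ps @ z # qs) = a * wedge f w (ps @ x # qs)"
  using assms(1)
proof (induction ps arbitrary: w)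
  case Nil
  from Nil[of "[]"] assms(2) show ?case by (simp add: wedge_linear algebra_simps)
next
  case (Cons p ps)
  have "wedge f (\<lambda>ys. w (p # ys)) (ps @ z # qs) = a * wedge f (\<lambda>ys. w (p # ys)) (ps @ x # qs)"
    by (rule Cons.IH) (use Cons.prems[of "p # ps" for ps] in simp)+
  moreover have "w (ps @ z # qs) = a * w (ps @ x # qs)"
    using Cons.prems[of ps] by simp
  ultimately show ?case by (simp add: distrib_left mult.left_commute)
qed

lemma deriv_act_add_slot:
  assumes "\<And>ps qs. w (ps @ z # qs) = w (ps @ x # qs) + w (ps @ y # qs)"
    and "\<And>ps qs. w (ps @ A z # qs) = w (ps @ A x # qs) + w (ps @ A y # qs)"
  shows "deriv_act A w (ps @ z # qs) = deriv_act A w (ps @ x # qs) + deriv_act A w (ps @ y # qs)"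
  using assms
proof (induction ps arbitrary: w)
  case Nil
  from Nil(1)[of "[]"] Nil(2)[of "[]"] show ?case by (simp add: deriv_act_linear algebra_simps)
next
  case (Cons p ps)
  have "deriv_act A (\<lambda>ys. w (p # ys)) (ps @ z # qs) = deriv_act A (\<lambda>ys. w (p # ys)) (ps @ x # qs) +
      deriv_act A (\<lambda>ys. w (p # ys)) (ps @ y # qs)"
    by (rule Cons.IH) (use Cons.prems[of "p # ps" for ps] in simp)+
  moreover have "w (A p # ps @ z # qs) = w (A p # ps @ x # qs) + w (A p # ps @ y # qs)"
    using Cons.prems(1)[of "A p # ps"] by simp
  ultimately show ?case by (simp add: add_ac distrib_left)
qed

lemma deriv_act_smult_slot:
  assumes "\<And>ps qs. w (ps @ z # qs) = a * w (ps @ x # qs)"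
    and "\<And>ps qs. w (ps @ A z # qs) = a * w (ps @ A x # qs)"
  shows "deriv_act A w (ps @ z # qs) = a * deriv_act A w (ps @ x # qs)"
  using assms
proof (induction ps arbitrary: w)
  case Nil
  from Nil(1)[of "[]"] Nil(2)[of "[]"] show ?case by (simp add: deriv_act_linear algebra_simps)
next
  case (Cons p ps)
  have "deriv_act A (\<lambda>ys. w (p # ys)) (ps @ z # qs) = a * deriv_act A (\<lambda>ys. w (p # ys)) (ps @ x # qs)"
    by (rule Cons.IH) (use Cons.prems[of "p # ps" for ps] in simp)+
  moreover have "w (A p # ps @ z # qs) = a * w (A p # ps @ x # qs)"
    using Cons.prems(1)[of "A p # ps"] by simp
  ultimately show ?case by (simp add: distrib_left mult.left_commute)
qed

text \<open>Meant for \<open>v\<close> the contraction of an alternating form with \<open>x\<close>.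
  Only the term in which \<open>f\<close> consumes the entry \<open>x\<close> survives.\<close>

lemma wedge_contract_null:
  assumes "\<And>ps qs. v (ps @ x # qs) = 0"
  shows "wedge f v (ps @ x # qs) = f x * v (ps @ qs)"
  using assms
proof (induction ps arbitrary: v)
  case Nil
  from Nil[of "[]"] show ?case by (simp add: wedge_linear)
next
  case (Cons p ps)
  have "wedge f (\<lambda>ys. v (p # ys)) (ps @ x # qs) = f x * v (p # ps @ qs)"
    by (rule Cons.IH) (use Cons.prems[of "p # ps" for ps] in simp)
  then show ?case using Cons.prems[of ps] by simp
qed

lemma deriv_act_contract_null:
  assumes "\<And>ps qs. v (ps @ x # qs) = 0"
  shows "deriv_act A v (ps @ x # qs) = v (ps @ A x # qs)"
  using assms
proof (induction ps arbitrary: v)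
  case Nil
  from Nil[of "[]"] show ?case by (simp add: deriv_act_linear)
next
  case (Cons p ps)
  have "deriv_act A (\<lambda>ys. v (p # ys)) (ps @ x # qs) = v (p # ps @ A x # qs)"
    by (rule Cons.IH) (use Cons.prems[of "p # ps" for ps] in simp)
  then show ?case using Cons.prems[of "A p # ps"] by simp
qed


section \<open>Sums over pairs of arguments\<close>

lemma nths_compl_Cons:
  "nths (x # xs) (- {0}) = xs"
  "nths (x # xs) (- {Suc j}) = x # nths xs (- {j})"
  "nths (x # xs) (- {0, Suc j}) = nths xs (- {j})"
  "nths (x # xs) (- {Suc i, Suc j}) = x # nths xs (- {i, j})"
  by (auto simp: nths_Cons nths_all intro: arg_cong[where f = "nths xs"])

text \<open>The shape of the Chevalley-Eilenberg coboundary without signs. The summand is abstract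
  so that an induction over the list can absorb the head into it.\<close>

definition pair_sum :: "('b \<Rightarrow> 'b \<Rightarrow> 'b list \<Rightarrow> 'a::comm_monoid_add) \<Rightarrow> 'b list \<Rightarrow> 'a" where
  "pair_sum h xs = (\<Sum>j<length xs. \<Sum>i<j. h (xs ! i) (xs ! j) (nths xs (- {i, j})))"

lemma pair_sum_Cons:
  "pair_sum h (x # xs) =
     (\<Sum>j<length xs. h x (xs ! j) (nths xs (- {j}))) + pair_sum (\<lambda>y z zs. h y z (x # zs)) xs"
  by (simp add: pair_sum_def sum.lessThan_Suc_shift nths_compl_Cons sum.distrib del: sum.lessThan_Suc)

lemma pair_sum_add:
  "pair_sum (\<lambda>x y zs. g x y zs + h x y zs) xs = pair_sum g xs + pair_sum h xs"
  by (simp add: pair_sum_def sum.distrib)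

lemma pair_sum_cong:
  assumes "\<And>x y zs. \<lbrakk>x \<in> set xs; y \<in> set xs\<rbrakk> \<Longrightarrow> g x y zs = h x y zs"
  shows "pair_sum g xs = pair_sum h xs"
  unfolding pair_sum_def using assms by (auto intro!: sum.cong)

lemma wedge_eq_sum: "wedge f w xs = (\<Sum>j<length xs. f (xs ! j) * w (nths xs (- {j})))"
  by (induction xs arbitrary: w)
    (simp_all add: sum.lessThan_Suc_shift nths_compl_Cons del: sum.lessThan_Suc)

text \<open>The derivation changes an entry in place, whereas the coboundary puts the new entry in
  front; the symmetry of \<open>w\<close> reconciles the two.\<close>

lemma deriv_act_eq_sum:
  assumes "\<And>ps x y qs. w (ps @ x # y # qs) = w (ps @ y # x # qs)"
  shows "deriv_act A w xs = (\<Sum>j<length xs. w (A (xs ! j) # nths xs (- {j})))"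
  using assms
proof (induction xs arbitrary: w)
  case (Cons x xs)
  have "deriv_act A (\<lambda>ys. w (x # ys)) xs = (\<Sum>j<length xs. w (x # A (xs ! j) # nths xs (- {j})))"
    by (rule Cons.IH) (use Cons.prems[of "x # ps" for ps] in simp)
  also have "\<dots> = (\<Sum>j<length xs. w (A (xs ! j) # x # nths xs (- {j})))"
    by (intro sum.cong refl) (use Cons.prems[of "[]"] in simp)
  finally show ?case
    by (simp add: sum.lessThan_Suc_shift nths_compl_Cons del: sum.lessThan_Suc)
qed simp

text \<open>Pairs containing the head \<open>x\<close> contribute \<open>f x\<close> times the
  derivative of \<open>w\<close>, plus \<open>f\<close> wedged with the contraction of
  \<open>w\<close> by \<open>A x\<close>. These are the terms that both recursions split off at
  \<open>x\<close>; the other pairs are the induction hypothesis.\<close>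

lemma pair_sum_eq_wedge_deriv_act:
  assumes "\<And>ps x y qs. w (ps @ x # y # qs) = w (ps @ y # x # qs)"
  shows "pair_sum (\<lambda>x y zs. f x * w (A y # zs) + f y * w (A x # zs)) xs = wedge f (deriv_act A w) xs"
  using assms
proof (induction xs arbitrary: w)
  case Nil
  then show ?case by (simp add: pair_sum_def)
next
  case (Cons x xs)
  have swap: "w (y # x # zs) = w (x # y # zs)" for y zs
    using Cons.prems[of "[]"] by simp
  have "pair_sum (\<lambda>y z zs. f y * w (x # A z # zs) + f z * w (x # A y # zs)) xs =
      wedge f (deriv_act A (\<lambda>ys. w (x # ys))) xs"
    by (rule Cons.IH) (use Cons.prems[of "x # ps" for ps] in simp)
  then show ?case
    by (simp add: pair_sum_Cons swap[of "A _"] sum.distrib wedge_linear add_ac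
        wedge_eq_sum[of f "\<lambda>ys. w (A x # ys)"] deriv_act_eq_sum[of w A xs, OF Cons.prems] sum_distrib_left)
qed


section \<open>Characteristic two\<close>

context
  fixes F :: "'a::field itself"
  assumes char_two: "CHAR('a) = 2"
begin

lemma two_eq_zero: "(2::'a) = 0"
  using of_nat_CHAR[where 'a = 'a] by (simp add: char_two)

lemma add_self: "x + x = (0::'a)"
  by (metis two_eq_zero mult_2 mult_zero_left)

lemma add_self_left: "x + (x + y) = (y::'a)"
  by (simp add: add.assoc[symmetric] add_self)

lemma uminus_eq: "- x = (x::'a)"
  using add_self[of x] by (simp add: minus_unique)

lemma diff_eq_add: "x - y = x + (y::'a)"
  by (metis add_uminus_conv_diff uminus_eq)

lemmas char_two_simps = add_self add_self_left uminus_eq add_ac distrib_left distrib_right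

lemma eq_if_add_zero: "x + y = 0 \<Longrightarrow> x = (y::'a)"
  using add_self_left[of x y] by simp

text \<open>Any two positions are consumed in both orders with the same coefficient, so the terms
  cancel in pairs. This holds for an arbitrary function \<open>w\<close>.\<close>

lemma wedge_wedge_self: "wedge f (wedge f w) xs = (0::'a)"
  by (induction xs arbitrary: w) (simp_all add: wedge_linear char_two_simps)

lemma wedge_commute: "wedge f (wedge g w) xs = (wedge g (wedge f w) xs :: 'a)"
  by (induction xs arbitrary: w) (simp_all add: wedge_linear add_ac)

text \<open>Terms with \<open>A\<close> at two different positions occur twice and cancel; those
  with \<open>A\<close> applied twice at one position remain.\<close>

lemma deriv_act_square: "deriv_act A (deriv_act A w) xs = (deriv_act (A \<circ> A) w xs :: 'a)"
  by (induction xs arbitrary: w) (simp_all add: deriv_act_linear char_two_simps)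

text \<open>Polarisation: alternation gives skew-symmetry, which is symmetry in characteristic two.
  Outside the carrier both sides are 0.\<close>

lemma alternating_forms_swap:
  fixes w :: "'b list \<Rightarrow> 'a"
  assumes V: "vectorspace class_ring V" and w: "w \<in> alternating_forms V k"
  shows "w (ps @ x # qs @ y # rs) = w (ps @ y # qs @ x # rs)"
proof (cases "x \<in> carrier V \<and> y \<in> carrier V")
  case True
  then have xy: "x \<in> carrier V" "y \<in> carrier V" by auto
  note D = alternating_formsD(2,4)[OF V w]
  have "0 = w (ps @ (x \<oplus>\<^bsub>V\<^esub> y) # qs @ (x \<oplus>\<^bsub>V\<^esub> y) # rs)" by (simp add: D)
  also have "\<dots> = w ((ps @ x # qs) @ (x \<oplus>\<^bsub>V\<^esub> y) # rs) + w ((ps @ y # qs) @ (x \<oplus>\<^bsub>V\<^esub> y) # rs)"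
    using xy by (simp add: D(1))
  also have "\<dots> = w (ps @ x # qs @ y # rs) + w (ps @ y # qs @ x # rs)"
    unfolding D(1)[OF xy] by (simp add: D(2))
  finally show ?thesis by (metis eq_if_add_zero)
next
  case False
  then show ?thesis by (subst (1 2) alternating_formsD(1)[OF V w]) (auto simp: tuples_def)
qed

lemma alternating_forms_move:
  fixes w :: "'b list \<Rightarrow> 'a"
  assumes V: "vectorspace class_ring V" and w: "w \<in> alternating_forms V k"
  shows "w (ps @ x # qs @ rs) = w (ps @ qs @ x # rs)"
proof (induction qs arbitrary: ps)
  case (Cons q qs)
  have "w (ps @ x # q # qs @ rs) = w ((ps @ [q]) @ x # qs @ rs)"
    using alternating_forms_swap[OF V w, of ps x "[]" q] by simp
  then show ?case using Cons.IH[of "ps @ [q]"] by simp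
qed simp

lemma wedge_alternating:
  fixes w :: "'b list \<Rightarrow> 'a"
  assumes V: "vectorspace class_ring V" and w: "w \<in> alternating_forms V k"
    and f: "\<And>x. x \<notin> carrier V \<Longrightarrow> f x = 0"
      "\<And>x y. \<lbrakk>x \<in> carrier V; y \<in> carrier V\<rbrakk> \<Longrightarrow> f (x \<oplus>\<^bsub>V\<^esub> y) = f x + f y"
      "\<And>a x. x \<in> carrier V \<Longrightarrow> f (a \<odot>\<^bsub>V\<^esub> x) = a * f x"
  shows "wedge f w \<in> alternating_forms V (Suc k)"
proof (rule alternating_formsI)
  note D = alternating_formsD[OF V]
  show "wedge f w xs = 0" if "xs \<notin> tuples V (Suc k)" for xs
    using D(1)[OF w] f(1) that by (rule wedge_notin_tuples)
  show "wedge f w (ps @ (x \<oplus>\<^bsub>V\<^esub> y) # qs) = wedge f w (ps @ x # qs) + wedge f w (ps @ y # qs)"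
    if "x \<in> carrier V" "y \<in> carrier V" for ps qs x y
    using that by (intro wedge_add_slot D(2)[OF w] f)
  show "wedge f w (ps @ (a \<odot>\<^bsub>V\<^esub> x) # qs) = a * wedge f w (ps @ x # qs)"
    if "x \<in> carrier V" for ps qs a x
    using that by (intro wedge_smult_slot D(3)[OF w] f)
  \<comment> \<open>Only the two terms in which \<open>f\<close> consumes a copy of \<open>x\<close>
    survive. They leave the same arguments up to order and cancel.\<close>
  have base: "wedge f w (x # qs @ x # rs) = 0" if w: "w \<in> alternating_forms V k" for k w qs rs x
  proof -
    have "wedge f (\<lambda>ys. w (x # ys)) (qs @ x # rs) = f x * w (x # qs @ rs)"
      by (rule wedge_contract_null) (use D(4)[OF w, of "[]"] in simp)
    moreover have "w (x # qs @ rs) = w (qs @ x # rs)"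
      using alternating_forms_move[OF V w, of "[]"] by simp
    ultimately show ?thesis by (simp add: add_self)
  qed
  show "wedge f w (ps @ x # qs @ x # rs) = 0" for ps qs rs x
    using w
  proof (induction ps arbitrary: w k)
    case Nil then show ?case by (simp only: append_Nil base)
  next
    case (Cons p ps)
    show ?case
    proof (cases k)
      case 0
      then have "w (p # ys) = 0" for ys using D(1)[OF Cons.prems] by (simp add: tuples_def)
      then show ?thesis using D(4)[OF Cons.prems, of ps] by (simp add: wedge_linear)
    next
      case (Suc j)
      have "wedge f (\<lambda>ys. w (p # ys)) (ps @ x # qs @ x # rs) = 0"
        by (rule Cons.IH[OF alternating_forms_contract[OF V]]) (use Cons.prems Suc in simp)
      then show ?thesis using D(4)[OF Cons.prems, of ps] by simp
    qed
  qed
qed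

lemma deriv_act_alternating:
  fixes w :: "'b list \<Rightarrow> 'a"
  assumes V: "vectorspace class_ring V" and w: "w \<in> alternating_forms V k"
    and A: "\<And>x. A x \<in> carrier V \<longleftrightarrow> x \<in> carrier V"
      "\<And>x y. \<lbrakk>x \<in> carrier V; y \<in> carrier V\<rbrakk> \<Longrightarrow> A (x \<oplus>\<^bsub>V\<^esub> y) = A x \<oplus>\<^bsub>V\<^esub> A y"
      "\<And>a x. x \<in> carrier V \<Longrightarrow> A (a \<odot>\<^bsub>V\<^esub> x) = a \<odot>\<^bsub>V\<^esub> A x"
  shows "deriv_act A w \<in> alternating_forms V k"
proof (rule alternating_formsI)
  note D = alternating_formsD[OF V]
  show "deriv_act A w xs = 0" if "xs \<notin> tuples V k" for xs
    using deriv_act_notin_tuples[of V k w A] D(1)[OF w] A(1) that by blast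
  show "deriv_act A w (ps @ (x \<oplus>\<^bsub>V\<^esub> y) # qs) =
      deriv_act A w (ps @ x # qs) + deriv_act A w (ps @ y # qs)"
    if "x \<in> carrier V" "y \<in> carrier V" for ps qs x y
    using that by (intro deriv_act_add_slot) (simp_all add: D(2)[OF w] A)
  show "deriv_act A w (ps @ (a \<odot>\<^bsub>V\<^esub> x) # qs) = a * deriv_act A w (ps @ x # qs)"
    if "x \<in> carrier V" for ps qs a x
    using that by (intro deriv_act_smult_slot) (simp_all add: D(3)[OF w] A)
  \<comment> \<open>The surviving terms have \<open>A\<close> on one or the other copy of
    \<open>x\<close>; they agree by symmetry and cancel.\<close>
  have base: "deriv_act A w (x # qs @ x # rs) = 0" if w: "w \<in> alternating_forms V k" for k w qs rs x
  proof -
    have "deriv_act A (\<lambda>ys. w (x # ys)) (qs @ x # rs) = w (x # qs @ A x # rs)"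
      by (rule deriv_act_contract_null) (use D(4)[OF w, of "[]"] in simp)
    moreover have "w (x # qs @ A x # rs) = w (A x # qs @ x # rs)"
      using alternating_forms_swap[OF V w, of "[]" x] by simp
    ultimately show ?thesis by (simp add: add_self)
  qed
  show "deriv_act A w (ps @ x # qs @ x # rs) = 0" for ps qs rs x
    using w
  proof (induction ps arbitrary: w k)
    case Nil then show ?case by (simp only: append_Nil base)
  next
    case (Cons p ps)
    show ?case
    proof (cases k)
      case 0
      then have "w (p # ys) = 0" for p ys using D(1)[OF Cons.prems] by (simp add: tuples_def)
      then show ?thesis by (simp add: deriv_act_linear)
    next
      case (Suc j)
      have "deriv_act A (\<lambda>ys. w (p # ys)) (ps @ x # qs @ x # rs) = 0"
        by (rule Cons.IH[OF alternating_forms_contract[OF V]]) (use Cons.prems Suc in simp)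
      then show ?thesis using D(4)[OF Cons.prems, of "A p # ps"] by simp
    qed
  qed
qed

text \<open>The two-term bracket covers both algebras: \<open>m0\<close> takes \<open>g\<close> to
  be zero, and \<open>m2\<close> takes the second coordinate together with the square of
  \<open>A\<close>.\<close>

lemma coboundary_eq_wedge_deriv_act:
  fixes L :: "('a, 'b, 'm) lie_algebra_scheme"
  assumes L: "vectorspace class_ring L" and w: "w \<in> alternating_forms L k"
    and closed: "\<And>x. x \<in> carrier L \<Longrightarrow> A x \<in> carrier L" "\<And>x. x \<in> carrier L \<Longrightarrow> B x \<in> carrier L"
    and bracket: "\<And>x y. \<lbrakk>x \<in> carrier L; y \<in> carrier L\<rbrakk> \<Longrightarrow> lie_bracket L x y =
      (f x \<odot>\<^bsub>L\<^esub> A y \<oplus>\<^bsub>L\<^esub> f y \<odot>\<^bsub>L\<^esub> A x) \<oplus>\<^bsub>L\<^esub> (g x \<odot>\<^bsub>L\<^esub> B y \<oplus>\<^bsub>L\<^esub> g y \<odot>\<^bsub>L\<^esub> B x)"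
    and xs: "xs \<in> tuples L (Suc k)"
  shows "coboundary L k w xs = wedge f (deriv_act A w) xs + wedge g (deriv_act B w) xs"
proof -
  interpret vectorspace class_ring L by (rule L)
  have sm: "a \<odot>\<^bsub>L\<^esub> x \<in> carrier L" if "x \<in> carrier L" for a :: 'a and x
    using smult_closed[of a x] that by simp
  note D = alternating_formsD(2,3)[OF L w, where ps = "[]", simplified]
  have swap: "w (ps @ x # y # qs) = w (ps @ y # x # qs)" for ps x y qs
    using alternating_forms_swap[OF L w, of ps x "[]" y] by simp
  have "coboundary L k w xs = pair_sum (\<lambda>x y zs. w (lie_bracket L x y # zs)) xs"
    using xs by (simp add: coboundary_def pair_sum_def tuples_def uminus_eq)
  also have "\<dots> = pair_sum (\<lambda>x y zs. (f x * w (A y # zs) + f y * w (A x # zs)) +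
      (g x * w (B y # zs) + g y * w (B x # zs))) xs"
    using xs by (intro pair_sum_cong) (auto simp: tuples_def bracket D closed sm subset_iff)
  also have "\<dots> = wedge f (deriv_act A w) xs + wedge g (deriv_act B w) xs"
    by (subst pair_sum_add) (simp only: pair_sum_eq_wedge_deriv_act[of w, OF swap])
  finally show ?thesis .
qed

section \<open>The isomorphism of cochain complexes\<close>

text \<open>Write a form on \<open>\<mm>\<^sub>0(n)\<close> as \<open>a + e\<^sup>1 \<and> b\<close> with \<open>a\<close>, \<open>b\<close> free of \<open>e\<^sup>1\<close>. For \<open>u = e\<^sub>1\<close>
  and \<open>g = e\<^sup>2\<close> the following map sends it to \<open>a + e\<^sup>1 \<and> b + e\<^sup>2 \<and> D b\<close>.\<close>

definition twist :: "('b \<Rightarrow> 'a) \<Rightarrow> ('b \<Rightarrow> 'b) \<Rightarrow> 'b \<Rightarrow> ('b list \<Rightarrow> 'a) \<Rightarrow> 'b list \<Rightarrow> 'a" where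
  "twist g A u w = (\<lambda>xs. w xs + wedge g (deriv_act A (\<lambda>ys. w (u # ys))) xs)"

lemma twist_linear:
  "twist g A u (\<lambda>xs. v xs + w xs) = (\<lambda>xs. twist g A u v xs + twist g A u w xs)"
  "twist g A u (\<lambda>xs. a * w xs) = (\<lambda>xs. a * twist g A u w xs)"
  by (simp_all add: twist_def deriv_act_linear_fun wedge_linear add_ac distrib_left)

text \<open>Write the twist as 1 + N with N w = g \<and> D (\<iota> w), \<iota> being contraction by
  \<open>u\<close>. Then 2N = 0, and N N = 0: both \<iota> and D pass through the factor
  \<open>g\<close> by the two assumptions, which leaves g \<and> g.\<close>

lemma twist_twist:
  assumes "g u = 0" "\<And>x. g (A x) = 0"
  shows "twist g A u (twist g A u w) = w"
proof
  fix xs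
  let ?D = "deriv_act A (\<lambda>ys. w (u # ys))"
  have "(\<lambda>ys. twist g A u w (u # ys)) = (\<lambda>ys. w (u # ys) + wedge g (\<lambda>zs. ?D (u # zs)) ys)"
    by (simp add: twist_def assms)
  then have "twist g A u (twist g A u w) xs =
      w xs + wedge g ?D xs + wedge g (\<lambda>ys. ?D ys + wedge g (deriv_act A (\<lambda>zs. ?D (u # zs))) ys) xs"
    by (simp add: twist_def[of g A u "twist g A u w"] deriv_act_linear_fun
        deriv_act_wedge[of g, OF assms(2)]) (simp add: twist_def)
  then show "twist g A u (twist g A u w) xs = w xs"
    by (simp add: wedge_linear wedge_wedge_self char_two_simps)
qed

text \<open>The assumption on \<open>w\<close> says that contraction by \<open>A u\<close> kills it,
  so D commutes with contraction by \<open>u\<close> on \<open>w\<close>.\<close>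

lemma twist_intertwines:
  assumes f: "f u = 1" "\<And>x. f (A x) = 0" and g: "\<And>x. g (A x) = 0"
    and w: "\<And>xs. w (A u # xs) = 0"
  shows "wedge f (deriv_act A (twist g A u w)) xs + wedge g (deriv_act (A \<circ> A) (twist g A u w)) xs =
    twist g A u (wedge f (deriv_act A w)) xs"
proof -
  let ?i = "\<lambda>ys. w (u # ys)"
  note lin = deriv_act_linear_fun
  note comm = deriv_act_wedge[of f, OF f(2)] deriv_act_wedge[of g, OF g]
  have DT: "deriv_act A (twist g A u w) =
      (\<lambda>xs. deriv_act A w xs + wedge g (deriv_act A (deriv_act A ?i)) xs)"
    by (simp add: twist_def lin comm)
  \<comment> \<open>The correction contributes to the first summand only; in the second it carries g
    \<and> g = 0.\<close>
  have "wedge f (deriv_act A (twist g A u w)) xs + wedge g (deriv_act (A \<circ> A) (twist g A u w)) xs =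
      wedge f (deriv_act A w) xs + wedge f (wedge g (deriv_act A (deriv_act A ?i))) xs
      + wedge g (deriv_act A (deriv_act A w)) xs"
    by (simp add: deriv_act_square[abs_def, symmetric] DT lin comm wedge_linear wedge_wedge_self add_ac)
  \<comment> \<open>Because \<open>f u\<close> is 1, contracting f \<and> D w by \<open>u\<close>
    gives D w + f \<and> D (\<iota> w). Applying D and then wedging with \<open>g\<close> yields the
    last two terms.\<close>
  also have "\<dots> = twist g A u (wedge f (deriv_act A w)) xs"
    by (simp add: twist_def f w lin comm wedge_linear wedge_commute[of g f] add_ac)
  finally show ?thesis .
qed

lemma twist_alternating:
  fixes w :: "'b list \<Rightarrow> 'a"
  assumes V: "vectorspace class_ring V" and w: "w \<in> alternating_forms V k"
    and g: "\<And>x. x \<notin> carrier V \<Longrightarrow> g x = 0"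
      "\<And>x y. \<lbrakk>x \<in> carrier V; y \<in> carrier V\<rbrakk> \<Longrightarrow> g (x \<oplus>\<^bsub>V\<^esub> y) = g x + g y"
      "\<And>a x. x \<in> carrier V \<Longrightarrow> g (a \<odot>\<^bsub>V\<^esub> x) = a * g x"
    and A: "\<And>x. A x \<in> carrier V \<longleftrightarrow> x \<in> carrier V"
      "\<And>x y. \<lbrakk>x \<in> carrier V; y \<in> carrier V\<rbrakk> \<Longrightarrow> A (x \<oplus>\<^bsub>V\<^esub> y) = A x \<oplus>\<^bsub>V\<^esub> A y"
      "\<And>a x. x \<in> carrier V \<Longrightarrow> A (a \<odot>\<^bsub>V\<^esub> x) = a \<odot>\<^bsub>V\<^esub> A x"
  shows "twist g A u w \<in> alternating_forms V k"
proof (cases k)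
  case 0
  \<comment> \<open>In degree 0 there is nothing to contract, so the twist is the identity.\<close>
  then have "w (u # ys) = 0" for ys
    using alternating_formsD(1)[OF V w] by (simp add: tuples_def)
  then show ?thesis using w by (simp add: twist_def deriv_act_linear_fun wedge_linear)
next
  case (Suc j)
  have "wedge g (deriv_act A (\<lambda>ys. w (u # ys))) \<in> alternating_forms V (Suc j)"
    by (intro wedge_alternating[OF V deriv_act_alternating[OF V alternating_forms_contract[OF V]]] g A)
      (use w Suc in auto)
  then show ?thesis unfolding twist_def using w Suc by (intro alternating_forms_add) auto
qed

end


section \<open>The Lie algebras \<open>\<mm>\<^sub>0(n)\<close> and \<open>\<mm>\<^sub>2(n)\<close> in characteristic two\<close>

text \<open>The conventions outside of the carrier make the operators on forms preserve the
  normalisation of forms to be \<open>0\<close> off the tuples of vectors.\<close>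

definition coord :: "nat \<Rightarrow> nat \<Rightarrow> (nat \<Rightarrow> 'a::field) \<Rightarrow> 'a" where
  "coord n i x = (if x \<in> carrier (m0 n) then x i else 0)"

definition ad_e1 :: "nat \<Rightarrow> (nat \<Rightarrow> 'a::field) \<Rightarrow> nat \<Rightarrow> 'a" where
  "ad_e1 n x = (if x \<in> carrier (m0 n) then \<lambda>l. if l \<in> {3..n} then x (l - 1) else 0 else x)"

lemma m0_simps:
  "carrier (m0 n) = {x. \<forall>i. i \<notin> {1..n} \<longrightarrow> x i = 0}"
  "x \<oplus>\<^bsub>m0 n\<^esub> y = (\<lambda>i. x i + y i)" "a \<odot>\<^bsub>m0 n\<^esub> x = (\<lambda>i. a * x i)"
  by (simp_all add: m0_def lie_of_basis_brackets_def)

lemma m2_simps: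
  "carrier (m2 n) = carrier (m0 n)"
  "x \<oplus>\<^bsub>m2 n\<^esub> y = x \<oplus>\<^bsub>m0 n\<^esub> y" "a \<odot>\<^bsub>m2 n\<^esub> x = a \<odot>\<^bsub>m0 n\<^esub> x"
  by (simp_all add: m0_def m2_def lie_of_basis_brackets_def)

lemma tuples_m2: "tuples (m2 n) k = tuples (m0 n) k"
  by (simp add: tuples_def m2_simps)

lemma alternating_forms_m2: "alternating_forms (m2 n) k = alternating_forms (m0 n) k"
  by (simp add: alternating_forms_def tuples_m2 m2_simps)

lemma coord_linear:
  "x \<notin> carrier (m0 n) \<Longrightarrow> coord n i x = 0"
  "\<lbrakk>x \<in> carrier (m0 n); y \<in> carrier (m0 n)\<rbrakk> \<Longrightarrow> coord n i (x \<oplus>\<^bsub>m0 n\<^esub> y) = coord n i x + coord n i y"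
  "x \<in> carrier (m0 n) \<Longrightarrow> coord n i (a \<odot>\<^bsub>m0 n\<^esub> x) = a * coord n i x"
  by (simp_all add: coord_def) (simp_all add: m0_simps)

lemma ad_e1_linear:
  "ad_e1 n x \<in> carrier (m0 n) \<longleftrightarrow> x \<in> carrier (m0 n)"
  "\<lbrakk>x \<in> carrier (m0 n); y \<in> carrier (m0 n)\<rbrakk> \<Longrightarrow>
    ad_e1 n (x \<oplus>\<^bsub>m0 n\<^esub> y) = ad_e1 n x \<oplus>\<^bsub>m0 n\<^esub> ad_e1 n y"
  "x \<in> carrier (m0 n) \<Longrightarrow> ad_e1 n (a \<odot>\<^bsub>m0 n\<^esub> x) = a \<odot>\<^bsub>m0 n\<^esub> ad_e1 n x"
proof -
  show "ad_e1 n x \<in> carrier (m0 n) \<longleftrightarrow> x \<in> carrier (m0 n)"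
    by (cases "x \<in> carrier (m0 n)") (auto simp: ad_e1_def, auto simp: m0_simps)
qed (auto simp: ad_e1_def m0_simps)

text \<open>The image of ad e_1 lies in the span of e_3, ..., e_n.\<close>

lemma coord_ad_e1: "i \<le> 2 \<Longrightarrow> coord n i (ad_e1 n x) = 0"
  by (auto simp: coord_def ad_e1_linear) (auto simp: ad_e1_def)

lemma m0_vectorspace: "vectorspace class_ring (m0 n :: ('a::field, nat \<Rightarrow> 'a) lie_algebra)"
  unfolding m0_def by (rule lie_of_basis_brackets_vectorspace)

lemma m2_vectorspace: "vectorspace class_ring (m2 n :: ('a::field, nat \<Rightarrow> 'a) lie_algebra)"
  unfolding m2_def by (rule lie_of_basis_brackets_vectorspace)

lemma m0_bracket_char_two:
  fixes x y :: "nat \<Rightarrow> 'a::field"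
  assumes "CHAR('a) = 2" "x \<in> carrier (m0 n)" "y \<in> carrier (m0 n)"
  shows "lie_bracket (m0 n) x y =
    coord n 1 x \<odot>\<^bsub>m0 n\<^esub> ad_e1 n y \<oplus>\<^bsub>m0 n\<^esub> coord n 1 y \<odot>\<^bsub>m0 n\<^esub> ad_e1 n x"
  using assms(2,3) uminus_eq[OF assms(1)]
  by (auto simp: fun_eq_iff m0_bracket_coord coord_def ad_e1_def m0_simps(2,3) diff_conv_add_uminus
      simp del: add_uminus_conv_diff)

text \<open>The square of \<open>ad e\<^sub>1\<close> sends \<open>e\<^sub>j\<close> to \<open>e\<^sub>j\<^sub>+\<^sub>2\<close> also for \<open>j = 2\<close>, where \<open>[e\<^sub>2, e\<^sub>2] = 0\<close>. This
  only adds \<open>x\<^sub>2 y\<^sub>2 + y\<^sub>2 x\<^sub>2 = 0\<close> to the coefficient of \<open>e\<^sub>4\<close>.\<close>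

lemma m2_bracket_char_two:
  fixes x y :: "nat \<Rightarrow> 'a::field"
  assumes "CHAR('a) = 2" "x \<in> carrier (m0 n)" "y \<in> carrier (m0 n)"
  shows "lie_bracket (m2 n) x y =
    (coord n 1 x \<odot>\<^bsub>m0 n\<^esub> ad_e1 n y \<oplus>\<^bsub>m0 n\<^esub> coord n 1 y \<odot>\<^bsub>m0 n\<^esub> ad_e1 n x) \<oplus>\<^bsub>m0 n\<^esub>
    (coord n 2 x \<odot>\<^bsub>m0 n\<^esub> (ad_e1 n \<circ> ad_e1 n) y \<oplus>\<^bsub>m0 n\<^esub> coord n 2 y \<odot>\<^bsub>m0 n\<^esub> (ad_e1 n \<circ> ad_e1 n) x)"
proof -
  \<comment> \<open>Both \<open>l\<close> and \<open>l - 1\<close> must lie in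
    \<open>{3..n}\<close>, hence the lower bound 4.\<close>
  have sq: "ad_e1 n (ad_e1 n z) l = (if l \<in> {4..n} then z (l - 2) else 0)"
    if "z \<in> carrier (m0 n)" for z :: "nat \<Rightarrow> 'a" and l
    using that ad_e1_linear(1)[of n z] by (auto simp: ad_e1_def numeral_eq_Suc)
  have ad: "ad_e1 n z l = (if l \<in> {3..n} then z (l - 1) else 0)"
    if "z \<in> carrier (m0 n)" for z :: "nat \<Rightarrow> 'a" and l
    using that by (simp add: ad_e1_def)
  have *: "lie_bracket (m2 n) x y l =
     (if l \<in> {3..n} then x 1 * y (l - 1) + x (l - 1) * y 1 else 0) +
     (if l \<in> {4..n} then x 2 * y (l - 2) + x (l - 2) * y 2 else 0)" for l
  proof (cases "l = 4")
    case True
    then show ?thesis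
      by (simp add: m2_bracket_coord diff_eq_add[OF assms(1)] add_self[OF assms(1)] mult.commute)
  next
    case False
    then have iff: "l \<in> {5..n} \<longleftrightarrow> l \<in> {4..n}" by auto
    show ?thesis unfolding m2_bracket_coord iff diff_eq_add[OF assms(1)] ..
  qed
  show ?thesis
  proof
    fix l
    show "lie_bracket (m2 n) x y l =
      ((coord n 1 x \<odot>\<^bsub>m0 n\<^esub> ad_e1 n y \<oplus>\<^bsub>m0 n\<^esub> coord n 1 y \<odot>\<^bsub>m0 n\<^esub> ad_e1 n x) \<oplus>\<^bsub>m0 n\<^esub>
       (coord n 2 x \<odot>\<^bsub>m0 n\<^esub> (ad_e1 n \<circ> ad_e1 n) y \<oplus>\<^bsub>m0 n\<^esub>
        coord n 2 y \<odot>\<^bsub>m0 n\<^esub> (ad_e1 n \<circ> ad_e1 n) x)) l"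
      unfolding * m0_simps(2,3) o_def
      using assms(2,3) by (simp add: sq ad coord_def mult.commute)
  qed
qed

section \<open>The two differentials as wedges with derivations\<close>

lemma coboundary_m0:
  fixes w :: "(nat \<Rightarrow> 'a::field) list \<Rightarrow> 'a"
  assumes c: "CHAR('a) = 2" and w: "w \<in> alternating_forms (m0 n) k"
  shows "coboundary (m0 n) k w = wedge (coord n 1) (deriv_act (ad_e1 n) w)"
    and "coboundary (m0 n) k w \<in> alternating_forms (m0 n) (Suc k)"
proof -
  \<comment> \<open>This also settles the lists off the tuples, where the coboundary is 0 by
    definition.\<close>
  have alt: "wedge (coord n 1) (deriv_act (ad_e1 n) w) \<in> alternating_forms (m0 n) (Suc k)"
    by (intro wedge_alternating[OF c m0_vectorspace deriv_act_alternating[OF c m0_vectorspace w]]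
        coord_linear ad_e1_linear)
  have "coboundary (m0 n) k w xs = wedge (coord n 1) (deriv_act (ad_e1 n) w) xs" for xs
  proof (cases "xs \<in> tuples (m0 n) (Suc k)")
    case True
    have "coboundary (m0 n) k w xs = wedge (coord n 1) (deriv_act (ad_e1 n) w) xs +
        wedge (\<lambda>x. 0) (deriv_act (ad_e1 n) w) xs"
      by (intro coboundary_eq_wedge_deriv_act[OF c m0_vectorspace w _ _ _ True])
        (simp_all add: ad_e1_linear m0_bracket_char_two[OF c], simp add: m0_simps)
    then show ?thesis by (simp add: wedge_eq_sum[of "\<lambda>x. 0"])
  next
    case False
    then show ?thesis using alternating_formsD(1)[OF m0_vectorspace alt] by (simp add: coboundary_def)
  qed
  then show "coboundary (m0 n) k w = wedge (coord n 1) (deriv_act (ad_e1 n) w)" by blast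
  with alt show "coboundary (m0 n) k w \<in> alternating_forms (m0 n) (Suc k)" by simp
qed

lemma coboundary_m2:
  fixes w :: "(nat \<Rightarrow> 'a::field) list \<Rightarrow> 'a"
  assumes c: "CHAR('a) = 2" and w: "w \<in> alternating_forms (m0 n) k"
  shows "coboundary (m2 n) k w = (\<lambda>xs. wedge (coord n 1) (deriv_act (ad_e1 n) w) xs +
    wedge (coord n 2) (deriv_act (ad_e1 n \<circ> ad_e1 n) w) xs)"
proof
  fix xs
  have alt: "wedge (coord n 1) (deriv_act (ad_e1 n) w) \<in> alternating_forms (m0 n) (Suc k)"
    "wedge (coord n 2) (deriv_act (ad_e1 n \<circ> ad_e1 n) w) \<in> alternating_forms (m0 n) (Suc k)"
    by (intro wedge_alternating[OF c m0_vectorspace deriv_act_alternating[OF c m0_vectorspace w]]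
        coord_linear; simp add: ad_e1_linear)+
  show "coboundary (m2 n) k w xs = wedge (coord n 1) (deriv_act (ad_e1 n) w) xs +
      wedge (coord n 2) (deriv_act (ad_e1 n \<circ> ad_e1 n) w) xs"
  proof (cases "xs \<in> tuples (m2 n) (Suc k)")
    case True
    then show ?thesis
      using w by (intro coboundary_eq_wedge_deriv_act[OF c m2_vectorspace])
        (simp_all add: alternating_forms_m2 m2_simps ad_e1_linear m2_bracket_char_two[OF c])
  next
    case False
    then show ?thesis
      using alternating_formsD(1)[OF m0_vectorspace alt(1)] alternating_formsD(1)[OF m0_vectorspace alt(2)]
      by (simp add: coboundary_def tuples_m2)
  qed
qed

theorem theorem1:
  fixes n k :: nat
  assumes "CHAR('a::field) = 2"
  shows "betti (m0 n :: ('a, nat \<Rightarrow> 'a) lie_algebra) k =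
         betti (m2 n :: ('a, nat \<Rightarrow> 'a) lie_algebra) k"
proof (cases "n = 0")
  \<comment> \<open>Without e_1 there is no vector to contract with, but for \<open>n = 0\<close>
    the two definitions coincide.\<close>
  case True
  then show ?thesis by (simp add: m0_def m2_def)
next
  case False
  note c = assms
  let ?f = "coord n 1 :: (nat \<Rightarrow> 'a) \<Rightarrow> 'a" and ?g = "coord n 2 :: (nat \<Rightarrow> 'a) \<Rightarrow> 'a"
  let ?A = "ad_e1 n :: (nat \<Rightarrow> 'a) \<Rightarrow> nat \<Rightarrow> 'a" and ?u = "basis_vec 1 :: nat \<Rightarrow> 'a"
  let ?T = "twist ?g ?A ?u"
  have u: "?u \<in> carrier (m0 n)" using False by (auto simp: m0_simps basis_vec_def)
  then have fu: "?f ?u = 1" and gu: "?g ?u = 0"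
    by (simp_all add: coord_def basis_vec_def)
  \<comment> \<open>Writing [e_1, e_1] = 0 as a zero multiple lets homogeneity of \<open>w\<close>
    give the vanishing required for intertwining.\<close>
  have Au: "?A ?u = 0 \<odot>\<^bsub>m0 n\<^esub> ?u"
    using u by (auto simp: ad_e1_def basis_vec_def m0_simps(3) fun_eq_iff)
  have fA: "?f (?A x) = 0" and gA: "?g (?A x) = 0" for x
    by (simp_all add: coord_ad_e1)
  show ?thesis
  proof (rule betti_eq_if_cochain_involution[where T = ?T])
    show "coboundary (m0 n) (Suc k) (coboundary (m0 n) k w) = (\<lambda>xs. 0)"
      if w: "w \<in> alternating_forms (m0 n) k" for k and w :: "(nat \<Rightarrow> 'a) list \<Rightarrow> 'a"
    proof -
      have "coboundary (m0 n) (Suc k) (coboundary (m0 n) k w) =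
          wedge ?f (deriv_act ?A (wedge ?f (deriv_act ?A w)))"
        using coboundary_m0[OF c w] coboundary_m0(1)[OF c] by metis
      \<comment> \<open>Since e^1 vanishes on the image of ad e_1, D passes e^1 and the square
        becomes e^1 \<and> e^1 \<and> D D w = 0.\<close>
      also have "deriv_act ?A (wedge ?f (deriv_act ?A w)) = wedge ?f (deriv_act ?A (deriv_act ?A w))"
by (rule deriv_act_wedge[of ?f, OF fA])
      finally show ?thesis by (simp add: wedge_wedge_self[OF c] fun_eq_iff)
    qed
    show "?T (?T w) = w" for w by (intro twist_twist c gu gA)
    show alt: "?T w \<in> alternating_forms (m0 n) k"
      if "w \<in> alternating_forms (m0 n) k" for k and w :: "(nat \<Rightarrow> 'a) list \<Rightarrow> 'a"
      by (intro twist_alternating[OF c m0_vectorspace that] coord_linear ad_e1_linear)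
    show "coboundary (m2 n) k (?T w) = ?T (coboundary (m0 n) k w)"
      if w: "w \<in> alternating_forms (m0 n) k" for k and w :: "(nat \<Rightarrow> 'a) list \<Rightarrow> 'a"
    proof -
      have wA: "w (?A ?u # xs) = 0" for xs
        using alternating_formsD(3)[OF m0_vectorspace w u, where ps = "[]" and a = 0] unfolding Au by simp
      show ?thesis
        unfolding coboundary_m0(1)[OF c w] coboundary_m2[OF c alt[OF w]]
        by (intro ext twist_intertwines c fu fA gA wA)
    qed
  qed (simp_all add: alternating_forms_m2 coboundary_m0(2)[OF c] twist_linear[OF c])
qed

end
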